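(* Let $m_n$ denote the minimum number of nonzero entries of an $n\times n$ irreducible sign pattern that is potentially stable. Then $m_7 = 2(7)-3 = 11$.
   Context: A real $n\times n$ matrix $A$ is stable if every (complex) eigenvalue $\lambda$ of $A$ satisfies $\mathrm{Re}(\lambda)<0$. The sign pattern of a real $n\times n$ matrix $A=[a_{ij}]$ is the $n\times n$ array $S(A)=[s_{ij}]$ with entries in $\{0,+,-\}$, where $s_{ij}=0$ if $a_{ij}=0$, $s_{ij}=-$ if $a_{ij}<0$, and $s_{ij}=+$ if $a_{ij}>0$. A sign pattern $S$ is potentially stable if there is a stable real matrix $A$ with $S(A)=S$. An $n\times n$ matrix (or sign pattern) is irreducible if there is no permutation matrix $P$ such that $PAP^T=\begin{bmatrix} A_{11} & 0 \\ A_{12} & A_{22} \end{bmatrix}$ with $A_{11}$ of size $k\times k$ and $A_{22}$ of size $(n-k)\times(n-k)$, $1\le k\le n-1$; equivalently, the digraph on $\{1,\dots,n\}$ with an edge $i\to j$ exactly when the $(i,j)$ entry is nonzero is strongly connected. *)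

theory Defs
  imports "Jordan_Normal_Form.Char_Poly" "HOL-Combinatorics.Permutations"
begin

definition stable :: "real mat \<Rightarrow> bool" where
  "stable A \<longleftrightarrow> (\<forall>l. eigenvalue (map_mat complex_of_real A) l \<longrightarrow> Re l < 0)"

datatype sign_entry = Zero_sign | Plus_sign | Minus_sign

(* Making the symbol 0 the zero of the type allows one notion of irreducibility
   to cover real matrices and sign patterns alike. *)
instantiation sign_entry :: zero
begin
definition zero_sign_entry :: sign_entry where "zero_sign_entry = Zero_sign"
instance ..
end

definition sign_of :: "real \<Rightarrow> sign_entry" where
  "sign_of x = (if x = 0 then Zero_sign else if x < 0 then Minus_sign else Plus_sign)"

definition sign_pattern :: "real mat \<Rightarrow> sign_entry mat" where
  "sign_pattern A = map_mat sign_of A"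

definition potentially_stable :: "nat \<Rightarrow> sign_entry mat \<Rightarrow> bool" where
  "potentially_stable n S \<longleftrightarrow> (\<exists>A \<in> carrier_mat n n. sign_pattern A = S \<and> stable A)"

definition permutation_mat :: "nat \<Rightarrow> (nat \<Rightarrow> nat) \<Rightarrow> 'a::{zero,one} mat" where
  "permutation_mat n p = mat n n (\<lambda>(i, j). if j = p i then 1 else 0)"

(* The product P A P^T for the permutation matrix P of p, written by reindexing
   so that it makes sense for entries that cannot be added or multiplied; the
   lemma below identifies the two when they can. *)
definition permute_mat :: "nat \<Rightarrow> (nat \<Rightarrow> nat) \<Rightarrow> 'a mat \<Rightarrow> 'a mat" where
  "permute_mat n p A = mat n n (\<lambda>(i, j). A $$ (p i, p j))"

lemma permute_mat_eq_conjugation: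
  fixes A :: "'a::semiring_1 mat"
  assumes p: "p permutes {..<n}" and A: "A \<in> carrier_mat n n"
  shows "permutation_mat n p * A * transpose_mat (permutation_mat n p) = permute_mat n p A"
proof (rule eq_matI)
  have pn: "p i < n" if "i < n" for i
    using permutes_in_image[OF p, of i] that by simp
  have PA: "(permutation_mat n p * A) $$ (i, j) = A $$ (p i, j)" if "i < n" "j < n" for i j
  proof -
    have "(permutation_mat n p * A) $$ (i, j) =
        (\<Sum>k\<in>{0..<n}. (if k = p i then 1 else 0) * A $$ (k, j))"
      using that A by (simp add: permutation_mat_def scalar_prod_def)
    also have "\<dots> = (\<Sum>k\<in>{0..<n}. if k = p i then A $$ (k, j) else 0)"
      by (rule sum.cong) auto
    also have "\<dots> = A $$ (p i, j)"
      using pn[OF \<open>i < n\<close>] by simp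
    finally show ?thesis .
  qed
  fix i j
  assume "i < dim_row (permute_mat n p A)" "j < dim_col (permute_mat n p A)"
  then have i: "i < n" and j: "j < n" by (simp_all add: permute_mat_def)
  have "(permutation_mat n p * A * transpose_mat (permutation_mat n p)) $$ (i, j) =
      (\<Sum>k\<in>{0..<n}. (permutation_mat n p * A) $$ (i, k) * (if k = p j then 1 else 0))"
    using i j A by (simp add: permutation_mat_def scalar_prod_def)
  also have "\<dots> = (\<Sum>k\<in>{0..<n}. if k = p j then A $$ (p i, k) else 0)"
    using PA i by (intro sum.cong) auto
  also have "\<dots> = A $$ (p i, p j)"
    using pn[OF j] by simp
  finally show "(permutation_mat n p * A * transpose_mat (permutation_mat n p)) $$ (i, j) =
      permute_mat n p A $$ (i, j)"
    using i j by (simp add: permute_mat_def)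
qed (simp_all add: permutation_mat_def permute_mat_def)

definition irreducible_mat :: "nat \<Rightarrow> 'a::zero mat \<Rightarrow> bool" where
  "irreducible_mat n A \<longleftrightarrow>
     \<not> (\<exists>p k A11 A12 A22. p permutes {..<n} \<and> 1 \<le> k \<and> k < n
          \<and> A11 \<in> carrier_mat k k
          \<and> A12 \<in> carrier_mat (n - k) k
          \<and> A22 \<in> carrier_mat (n - k) (n - k)
          \<and> permute_mat n p A = four_block_mat A11 (0\<^sub>m k (n - k)) A12 A22)"

definition num_nonzero :: "'a::zero mat \<Rightarrow> nat" where
  "num_nonzero A = card {(i, j). i < dim_row A \<and> j < dim_col A \<and> A $$ (i, j) \<noteq> 0}"

(* Inf on nat is the least element of a nonempty set and 0 on the empty set, so a
   positive value certifies that the minimum is attained. *)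
definition min_nonzero :: "nat \<Rightarrow> nat" where
  "min_nonzero n = Inf {num_nonzero S | S.
     S \<in> carrier_mat n n \<and> irreducible_mat n S \<and> potentially_stable n S}"

end

(* Lower bound. A stable 7 x 7 matrix has a characteristic polynomial
   x^7 + a_1 x^6 + ... + a_7 with positive coefficients, and splitting off real factors of degree 1
   and 2 shows a_i a_j > a_(i-1) a_(j+1) whenever i < j and i + j is odd. Now a_k is a signed sum over
   the families of disjoint cycles that cover k vertices in all, so such families exist for every k.
   From k = 1 there is a loop, and if there is only one loop, k = 2 yields a 2-cycle. A strongly
   connected digraph grows by ears from a cycle; with at most 10 arcs there is room for only two
   further ears, hence for only finitely many digraphs, given by few parameters. In most of them some
   k is not covered. In the remaining 30 digraphs the coefficients satisfy one of the relations
   a_3 = a_1 a_2, a_5 = a_1 a_4, a_7 = a_1 a_6, a_4 = a_1 (a_3 - a_1 a_2), or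
   a_4 = a_1 a_3 and a_6 = a_1 a_5 and a_7 = a_2 a_5, and each contradicts the inequalities.

   Upper bound. An explicit matrix with 11 nonzero entries has characteristic polynomial
   x^7 + 3 x^6 + 6 x^5 + 9 x^4 + 5 x^3 + 6 x^2 + x + 1, which the Routh scheme shows to be stable. *)

theory Submission
  imports Defs
begin

section \<open>Coefficients of real Hurwitz polynomials\<close>

text \<open>The parity condition is essential: for \<open>x^2 + b x + s\<close> with non-real roots
  \<open>b^2 - s\<close> may be negative, so Hurwitz polynomials need not have log-concave
  coefficients. For odd \<open>i + j\<close> the differences are 2 x 2 minors from two adjacent rows
  of the Hurwitz matrix, and their signs survive multiplication by a stable linear or quadratic
  factor.

  An ear has one arc more than it has new vertices. Hence a cycle with \<open>e\<close> further ears
  on 7 vertices has \<open>7 + e\<close> arcs, and \<open>l\<close> loops leave \<open>e\<close> at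
  most \<open>3 - l\<close>: one loop allows a 2-cycle with two ears, two loops a cycle through a
  loop vertex with one ear, three loops only a Hamiltonian cycle.

  Signs are never enumerated. Coverage depends on the support alone, and the relations are
  polynomial identities in arbitrary real entries: a surviving digraph has so few disjoint cycles
  that some coefficients factor.\<close>

definition hurwitz :: "real poly \<Rightarrow> bool" where
  "hurwitz p \<longleftrightarrow> (\<forall>z. poly (map_poly complex_of_real p) z = 0 \<longrightarrow> Re z < 0)"

interpretation of_real_poly_hom: map_poly_comm_ring_hom "of_real :: real \<Rightarrow> complex" ..

text \<open>Extending by 0 to negative indices turns multiplication by a factor into a uniform index
  shift without boundary cases.\<close>

definition int_coeff :: "real poly \<Rightarrow> int \<Rightarrow> real" where
  "int_coeff p k = (if k < 0 then 0 else coeff p (nat k))"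

lemma int_coeff_linear_mult:
  "int_coeff ([:r, 1:] * p) k = r * int_coeff p k + int_coeff p (k - 1)"
proof (cases "k \<le> 0")
  case False
  then have "nat k = Suc (nat (k - 1))" by simp
  then show ?thesis using False by (simp add: int_coeff_def)
qed (auto simp: int_coeff_def)

lemma int_coeff_quadratic_mult:
  "int_coeff ([:s, b, 1:] * p) k =
     s * int_coeff p k + b * int_coeff p (k - 1) + int_coeff p (k - 2)"
proof -
  have "[:s, b, 1:] * p = Polynomial.smult s p + pCons 0 ([:b, 1:] * p)" by simp
  moreover have "int_coeff (Polynomial.smult s p + pCons 0 q) k = s * int_coeff p k + int_coeff q (k - 1)" for q
  proof (cases "k \<le> 0")
    case False
    then have "nat k = Suc (nat (k - 1))" by simp
    then show ?thesis using False by (simp add: int_coeff_def)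
  qed (auto simp: int_coeff_def)
  ultimately show ?thesis by (simp only: int_coeff_linear_mult) simp
qed

definition coeff_minor :: "(int \<Rightarrow> real) \<Rightarrow> int \<Rightarrow> int \<Rightarrow> real" where
  "coeff_minor c i j = c i * c j - c (i - 1) * c (j + 1)"

text \<open>The weak inequality ranges over all integers because the induction shifts indices past
  both ends; there a minor may be 0, so strictness is claimed only inside.\<close>

definition minors_positive :: "int \<Rightarrow> (int \<Rightarrow> real) \<Rightarrow> bool" where
  "minors_positive n c \<longleftrightarrow>
     (\<forall>i. 0 \<le> i \<and> i \<le> n \<longrightarrow> c i > 0) \<and> (\<forall>i. i < 0 \<or> n < i \<longrightarrow> c i = 0) \<and>
     (\<forall>i j. i < j \<and> odd (i + j) \<longrightarrow> coeff_minor c i j \<ge> 0) \<and>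
     (\<forall>i j. 0 \<le> i \<and> i < j \<and> j \<le> n \<and> odd (i + j) \<longrightarrow> coeff_minor c i j > 0)"

lemma minors_positiveD:
  assumes "minors_positive n c"
  shows "0 \<le> i \<Longrightarrow> i \<le> n \<Longrightarrow> c i > 0" "i < 0 \<Longrightarrow> c i = 0" "n < i \<Longrightarrow> c i = 0" "c i \<ge> 0"
    "i < j \<Longrightarrow> odd (i + j) \<Longrightarrow> coeff_minor c i j \<ge> 0"
    "0 \<le> i \<Longrightarrow> i < j \<Longrightarrow> j \<le> n \<Longrightarrow> odd (i + j) \<Longrightarrow> coeff_minor c i j > 0"
proof -
  show "c i \<ge> 0"
    using assms unfolding minors_positive_def
    by (cases "i < 0 \<or> n < i") (auto intro: less_imp_le simp: not_less)
qed (use assms in \<open>auto simp: minors_positive_def\<close>)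

text \<open>Multiply the weak inequalities at \<open>(i, j)\<close> and
  \<open>(i - 1, j - 1)\<close> and cancel \<open>c (i - 1) * c j\<close>. Where this factor may
  vanish, the smaller side is 0. Such differences of even index sum are the mixed terms in the two
  expansions that follow.\<close>

lemma minors_positive_wide:
  assumes c: "minors_positive n c" and ij: "i < j" "odd (i + j)"
  shows "c i * c (j - 1) \<ge> c (i - 2) * c (j + 1)"
proof -
  consider "i \<le> 0" | "j \<ge> n" | "1 \<le> i" "j < n" by linarith
  then show ?thesis
  proof cases
    case 3
    have pos: "c (i - 1) > 0" "c j > 0"
      using minors_positiveD(1)[OF c] 3 ij by auto
    have "coeff_minor c i j \<ge> 0" "coeff_minor c (i - 1) (j - 1) \<ge> 0"
      using ij by (auto intro!: minors_positiveD(5)[OF c])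
    then have "c (i - 1) * c (j + 1) \<le> c i * c j" "c (i - 2) * c j \<le> c (i - 1) * c (j - 1)"
      by (simp_all add: coeff_minor_def)
    then have "(c (i - 1) * c (j + 1)) * (c (i - 2) * c j) \<le> (c i * c j) * (c (i - 1) * c (j - 1))"
      by (rule mult_mono) (auto intro!: mult_nonneg_nonneg minors_positiveD(4)[OF c])
    then have "(c (i - 1) * c j) * (c (i - 2) * c (j + 1)) \<le> (c (i - 1) * c j) * (c i * c (j - 1))"
      by (simp add: mult_ac)
    then show ?thesis using pos by (simp add: mult_le_cancel_left_pos)
  qed (use minors_positiveD(2-4)[OF c] in auto)
qed

text \<open>A minor of the product is a combination with positive factors of two minors of
  \<open>c\<close> and one difference of the previous kind. The shifted minor is strict, except at
  \<open>i = 0\<close>, where the subtracted product is 0.\<close>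

lemma minors_positive_linear_mult:
  assumes c: "minors_positive n c" and r: "r > 0" and n: "n \<ge> 0"
    and c': "\<And>k. c' k = r * c k + c (k - 1)"
  shows "minors_positive (n + 1) c'"
  unfolding minors_positive_def
proof (intro conjI allI impI)
  note D = minors_positiveD[OF c]
  show pos: "c' i > 0" if "0 \<le> i \<and> i \<le> n + 1" for i
  proof (cases "i \<le> n")
    case True
    then show ?thesis using D(1)[of i] D(4)[of "i - 1"] r that by (auto simp: c' intro: add_pos_nonneg)
  next
    case False
    then show ?thesis using D(1)[of "i - 1"] D(4)[of i] r n that
      by (auto simp: c' intro: add_nonneg_pos)
  qed
  show zero: "c' i = 0" if "i < 0 \<or> n + 1 < i" for i
    using D(2,3) that by (auto simp: c')
  have eq: "coeff_minor c' i j = r\<^sup>2 * coeff_minor c i j + coeff_minor c (i - 1) (j - 1)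
      + r * (c i * c (j - 1) - c (i - 2) * c (j + 1))" for i j
    by (simp add: coeff_minor_def c' power2_eq_square algebra_simps)
  have wide: "r * (c i * c (j - 1) - c (i - 2) * c (j + 1)) \<ge> 0" if "i < j" "odd (i + j)" for i j
    using minors_positive_wide[OF c that] r by simp
  show "coeff_minor c' i j \<ge> 0" if "i < j \<and> odd (i + j)" for i j
    unfolding eq using D(5)[of i j] D(5)[of "i - 1" "j - 1"] that wide[of i j] by simp
  show "coeff_minor c' i j > 0" if *: "0 \<le> i \<and> i < j \<and> j \<le> n + 1 \<and> odd (i + j)" for i j
  proof (cases "i = 0")
    case True
    then show ?thesis using pos[of 0] pos[of j] zero[of "-1"] * n by (simp add: coeff_minor_def)
  next
    case False
    then have "coeff_minor c (i - 1) (j - 1) > 0"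
      using * by (intro D(6)) auto
    then show ?thesis
      unfolding eq using D(5)[of i j] * wide[of i j] by (simp add: add_nonneg_pos add_pos_nonneg)
  qed
qed

lemma minors_positive_quadratic_mult:
  assumes c: "minors_positive n c" and b: "b > 0" and s: "s > 0" and n: "n \<ge> 0"
    and c': "\<And>k. c' k = s * c k + b * c (k - 1) + c (k - 2)"
  shows "minors_positive (n + 2) c'"
  unfolding minors_positive_def
proof (intro conjI allI impI)
  note D = minors_positiveD[OF c]
  show pos: "c' i > 0" if i: "0 \<le> i \<and> i \<le> n + 2" for i
  proof -
    have nonneg: "s * c i \<ge> 0" "b * c (i - 1) \<ge> 0" "c (i - 2) \<ge> 0"
      using D(4) b s by simp_all
    consider "i \<le> n" | "i = n + 1" | "i = n + 2" using i by linarith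
    then show ?thesis
    proof cases
      case 1
      then have "s * c i > 0" using D(1)[of i] s i by simp
      then show ?thesis unfolding c' using nonneg by linarith
    next
      case 2
      then have "b * c (i - 1) > 0" using D(1)[of n] b n by simp
      then show ?thesis unfolding c' using nonneg by linarith
    next
      case 3
      then have "c (i - 2) > 0" using D(1)[of n] n by simp
      then show ?thesis unfolding c' using nonneg by linarith
    qed
  qed
  show zero: "c' i = 0" if "i < 0 \<or> n + 2 < i" for i
    using D(2,3) that by (auto simp: c')
  have eq: "coeff_minor c' i j =
      s\<^sup>2 * coeff_minor c i j + b\<^sup>2 * coeff_minor c (i - 1) (j - 1) + coeff_minor c (i - 2) (j - 2)
      + b * s * (c i * c (j - 1) - c (i - 2) * c (j + 1))
      + s * (c i * c (j - 2) - c (i - 1) * c (j - 1)) + s * coeff_minor c (i - 2) j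
      + b * (c (i - 1) * c (j - 2) - c (i - 3) * c j)" for i j
    by (simp add: coeff_minor_def c' power2_eq_square algebra_simps)
  have nonneg: "s\<^sup>2 * coeff_minor c i j \<ge> 0" "b\<^sup>2 * coeff_minor c (i - 1) (j - 1) \<ge> 0"
    "coeff_minor c (i - 2) (j - 2) \<ge> 0"
    "b * s * (c i * c (j - 1) - c (i - 2) * c (j + 1)) \<ge> 0"
    "s * (c i * c (j - 2) - c (i - 1) * c (j - 1)) \<ge> 0" "s * coeff_minor c (i - 2) j \<ge> 0"
    "b * (c (i - 1) * c (j - 2) - c (i - 3) * c j) \<ge> 0"
    if ij: "i < j" "odd (i + j)" for i j
  proof -
    show "s\<^sup>2 * coeff_minor c i j \<ge> 0" "b\<^sup>2 * coeff_minor c (i - 1) (j - 1) \<ge> 0"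
      "coeff_minor c (i - 2) (j - 2) \<ge> 0" "s * coeff_minor c (i - 2) j \<ge> 0"
      using D(5)[of i j] D(5)[of "i - 1" "j - 1"] D(5)[of "i - 2" "j - 2"] D(5)[of "i - 2" j] ij s
      by simp_all
    show "b * s * (c i * c (j - 1) - c (i - 2) * c (j + 1)) \<ge> 0"
      using minors_positive_wide[OF c ij] b s by simp
    show "b * (c (i - 1) * c (j - 2) - c (i - 3) * c j) \<ge> 0"
      using minors_positive_wide[OF c, of "i - 1" "j - 1"] ij b by simp
    \<comment> \<open>Parity excludes \<open>j = i + 2\<close>, where the difference would be
      \<open>c i * c i - c (i - 1) * c (i + 1)\<close>, of unknown sign. At \<open>j = i + 1\<close>
      the two products coincide.\<close>
    have "j \<noteq> i + 2" using ij by auto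
    then consider "j = i + 1" | "i < j - 2" using ij by linarith
    then show "s * (c i * c (j - 2) - c (i - 1) * c (j - 1)) \<ge> 0"
    proof cases
      case 2
      then have "coeff_minor c i (j - 2) \<ge> 0" using ij by (intro D(5)) auto
      then show ?thesis using s by (simp add: coeff_minor_def)
    qed simp
  qed
  show "coeff_minor c' i j \<ge> 0" if "i < j \<and> odd (i + j)" for i j
    unfolding eq using nonneg[of i j] that by linarith
  show "coeff_minor c' i j > 0" if *: "0 \<le> i \<and> i < j \<and> j \<le> n + 2 \<and> odd (i + j)" for i j
  proof -
    \<comment> \<open>The minor shifted by 1 or by 2 is strict except when \<open>i = 0\<close> or
      \<open>(i, j) = (1, n + 2)\<close>; there the subtracted product has a vanishing
      factor.\<close>
    consider "i = 0" | "j = n + 2" "i = 1" | "j \<le> n + 1" "i \<ge> 1" | "i \<ge> 2"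
      using * by linarith
    then show ?thesis
    proof cases
      case 1
      then show ?thesis using pos[of 0] pos[of j] zero[of "-1"] * n by (simp add: coeff_minor_def)
    next
      case 2
      then show ?thesis using pos[of i] pos[of j] zero[of "j + 1"] * n by (simp add: coeff_minor_def)
    next
      case 3
      then have "coeff_minor c (i - 1) (j - 1) > 0"
        using * by (intro D(6)) auto
      then have "b\<^sup>2 * coeff_minor c (i - 1) (j - 1) > 0" using b by simp
      then show ?thesis unfolding eq using nonneg[of i j] * by linarith
    next
      case 4
      then have "coeff_minor c (i - 2) (j - 2) > 0"
        using * by (intro D(6)) auto
      then show ?thesis unfolding eq using nonneg[of i j] * by linarith
    qed
  qed
qed

lemma hurwitz_factor: "hurwitz (q * p) \<Longrightarrow> hurwitz p"
  by (simp add: hurwitz_def of_real_poly_hom.hom_mult)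

text \<open>The quadratic is \<open>(x - z) (x - cnj z)\<close>. The remainder is real of degree at
  most 1, and such a polynomial vanishes at a non-real point only if it is 0.\<close>

lemma poly_of_real_cnj_root:
  fixes p :: "real poly"
  assumes "poly (map_poly complex_of_real p) z = 0" "Im z \<noteq> 0"
  shows "[:(cmod z)\<^sup>2, - 2 * Re z, 1:] dvd p"
proof -
  define q where "q = [:(cmod z)\<^sup>2, - 2 * Re z, 1:]"
  have q0: "poly (map_poly complex_of_real q) z = 0"
    unfolding q_def by (simp add: complex_eq_iff cmod_power2) (simp add: power2_eq_square algebra_simps)
  define m where "m = p mod q"
  have "p = p div q * q + m" by (simp add: m_def)
  then have "poly (map_poly complex_of_real p) z =
      poly (map_poly complex_of_real (p div q)) z * poly (map_poly complex_of_real q) z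
      + poly (map_poly complex_of_real m) z"
    by (metis of_real_poly_hom.hom_add of_real_poly_hom.hom_mult poly_add poly_mult)
  then have m0: "poly (map_poly complex_of_real m) z = 0" using assms q0 by simp
  have "m = 0 \<or> degree m < degree q"
    unfolding m_def by (rule degree_mod_less) (simp add: q_def)
  then have "degree m < 2" by (auto simp: q_def)
  then obtain u v where m: "m = [:u, v:]"
    by (metis degree_eq_zeroE degree_pCons_eq_if less_2_cases_iff not_less_eq pCons_cases
        pCons_0_0 less_Suc_eq One_nat_def numeral_2_eq_2 zero_less_Suc)
  have "of_real u + z * of_real v = 0"
    using m0 by (simp add: m of_real_hom.map_poly_pCons_hom)
  then have "v = 0" "u = 0" using assms(2) by (auto simp: complex_eq_iff)
  then have "m = 0" by (simp add: m)
  then show ?thesis by (simp add: m_def q_def mod_eq_0_iff_dvd)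
qed

lemma hurwitz_minors_positive:
  assumes "hurwitz p" "lead_coeff p = 1"
  shows "minors_positive (int (degree p)) (int_coeff p)"
  using assms
proof (induction "degree p" arbitrary: p rule: less_induct)
  case less
  show ?case
  proof (cases "degree p = 0")
    case True
    with less.prems have p: "p = 1" by (metis degree_eq_zeroE lead_coeff_pCons(2) one_pCons pCons_0_0)
    show ?thesis
      by (auto simp: p minors_positive_def int_coeff_def coeff_minor_def coeff_eq_0)
  next
    case False
    let ?P = "map_poly complex_of_real p"
    have "degree ?P \<noteq> 0" using False by simp
    then obtain z where z: "poly ?P z = 0"
      by (metis constant_degree fundamental_theorem_of_algebra)
    then have Re: "Re z < 0" using less.prems by (simp add: hurwitz_def)
    show ?thesis
    proof (cases "Im z = 0")
      case True
      then have "z = of_real (Re z)" by (simp add: complex_eq_iff)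
      then have "poly p (Re z) = 0"
        using z by (metis of_real_eq_0_iff of_real_hom.poly_map_poly)
      then obtain q where q: "p = [:- Re z, 1:] * q"
        by (metis poly_eq_0_iff_dvd dvdE)
      have q0: "q \<noteq> 0" using q less.prems by auto
      have deg: "degree p = degree q + 1" using q q0 by (simp add: degree_mult_eq del: mult_pCons_left)
      have lc: "lead_coeff q = 1" using less.prems(2) unfolding q lead_coeff_mult by simp
      have "minors_positive (int (degree q)) (int_coeff q)"
        using less.hyps[of q] deg lc hurwitz_factor[OF less.prems(1)[unfolded q]] by simp
      then have "minors_positive (int (degree q) + 1) (int_coeff p)"
        by (rule minors_positive_linear_mult[where r = "- Re z"])
          (use Re in \<open>simp_all add: q int_coeff_linear_mult del: mult_pCons_left\<close>)
      then show ?thesis by (simp add: deg add.commute)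
    next
      case False
      then obtain q where q: "p = [:(cmod z)\<^sup>2, - 2 * Re z, 1:] * q"
        using poly_of_real_cnj_root[OF z] by (metis dvdE)
      have q0: "q \<noteq> 0" using q less.prems by auto
      have deg: "degree p = degree q + 2" using q q0 by (simp add: degree_mult_eq del: mult_pCons_left)
      have lc: "lead_coeff q = 1" using less.prems(2) unfolding q lead_coeff_mult by simp
      have "minors_positive (int (degree q)) (int_coeff q)"
        using less.hyps[of q] deg lc hurwitz_factor[OF less.prems(1)[unfolded q]] by simp
      then have "minors_positive (int (degree q) + 2) (int_coeff p)"
        by (rule minors_positive_quadratic_mult[where s = "(cmod z)\<^sup>2" and b = "- 2 * Re z"])
          (use Re False in \<open>auto simp: q int_coeff_quadratic_mult simp del: mult_pCons_left\<close>)
      then show ?thesis by (simp add: deg add.commute)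
    qed
  qed
qed

lemma hurwitz_coeffs:
  assumes "hurwitz p" "lead_coeff p = 1"
  shows "k \<le> degree p \<Longrightarrow> coeff p k > 0"
    and "1 \<le> i \<Longrightarrow> i < j \<Longrightarrow> j \<le> degree p \<Longrightarrow> odd (i + j) \<Longrightarrow>
      coeff p (i - 1) * coeff p (j + 1) < coeff p i * coeff p j"
proof -
  note D = minors_positiveD[OF hurwitz_minors_positive[OF assms]]
  show "coeff p k > 0" if "k \<le> degree p"
    using D(1)[of "int k"] that by (simp add: int_coeff_def)
  show "coeff p (i - 1) * coeff p (j + 1) < coeff p i * coeff p j"
    if "1 \<le> i" "i < j" "j \<le> degree p" "odd (i + j)"
    using D(6)[of "int i" "int j"] that
    by (simp add: int_coeff_def coeff_minor_def nat_diff_distrib nat_add_distrib)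
qed

section \<open>The characteristic polynomial as a sum over cycle covers\<close>

lemma stable_hurwitz:
  assumes "A \<in> carrier_mat n n"
  shows "stable A \<longleftrightarrow> hurwitz (char_poly A)"
proof -
  have "eigenvalue (map_mat complex_of_real A) z \<longleftrightarrow> poly (map_poly complex_of_real (char_poly A)) z = 0" for z
    using assms eigenvalue_root_char_poly[of "map_mat complex_of_real A" n z]
      of_real_hom.char_poly_hom[OF assms, where ?'a = complex] by simp
  then show ?thesis by (simp add: stable_def hurwitz_def)
qed

primrec index_of :: "nat \<Rightarrow> nat list \<Rightarrow> nat" where
  "index_of j [] = 0"
| "index_of j (x # xs) = (if j = x then 0 else Suc (index_of j xs))"

lemma index_of_nth: "distinct xs \<Longrightarrow> b < length xs \<Longrightarrow> index_of (xs ! b) xs = b"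
  by (induction xs arbitrary: b) (auto simp: nth_Cons split: nat.split)

lemma remove1_nth:
  "distinct xs \<Longrightarrow> b < length xs \<Longrightarrow> remove1 (xs ! b) xs = take b xs @ drop (Suc b) xs"
  by (induction xs arbitrary: b) (auto simp: nth_Cons split: nat.split)

text \<open>Laplace expansion of \<open>det (x I - B)\<close> from row \<open>i\<close> on, with \<open>cs\<close> the columns still available and
  \<open>rs\<close> the lists of columns where these rows may be nonzero. A result \<open>(m, w)\<close> stands for a term
  that uses \<open>m\<close> entries of \<open>B\<close> and for the remaining rows the diagonal entry \<open>x\<close>.\<close>

fun cover_terms :: "(nat \<Rightarrow> nat \<Rightarrow> real) \<Rightarrow> nat list list \<Rightarrow> nat \<Rightarrow> nat list \<Rightarrow> (nat \<times> real) list" where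
  "cover_terms B [] i cs = [(0, 1)]"
| "cover_terms B (r # rs) i cs =
    (if i \<in> set cs then
      map (apsnd ((*) ((- 1) ^ index_of i cs))) (cover_terms B rs (Suc i) (remove1 i cs)) else []) @
    concat (map (\<lambda>j. if j \<in> set cs then
      map (map_prod Suc ((*) ((- 1) ^ Suc (index_of j cs) * B i j))) (cover_terms B rs (Suc i) (remove1 j cs))
      else []) r)"

definition terms_poly :: "nat \<Rightarrow> (nat \<times> real) list \<Rightarrow> real poly" where
  "terms_poly n T = (\<Sum>(m, w)\<leftarrow>T. monom w (n - m))"

definition xI_minus :: "(nat \<Rightarrow> nat \<Rightarrow> real) \<Rightarrow> nat \<Rightarrow> nat \<Rightarrow> real poly" where
  "xI_minus B i j = (if i = j then [:0, 1:] else 0) - [:B i j:]"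

lemma cover_terms_size: "(m, w) \<in> set (cover_terms B rs i cs) \<Longrightarrow> m \<le> length rs"
  by (induction B rs i cs arbitrary: m w rule: cover_terms.induct)
    (fastforce split: if_splits)+

text \<open>Remaining columns are kept as a list, so deleting one is \<open>remove1\<close> and the
  cofactor sign is read off from its position.\<close>

lemma det_laplace_cols:
  fixes M :: "nat \<Rightarrow> nat \<Rightarrow> 'a::comm_ring_1"
  assumes "distinct cs" "length cs = Suc n"
  shows "det (mat (Suc n) (Suc n) (\<lambda>(a, b). M (i + a) (cs ! b))) =
    (\<Sum>j\<in>set cs. (- 1) ^ index_of j cs * M i j *
      det (mat n n (\<lambda>(a, b). M (Suc i + a) (remove1 j cs ! b))))"
proof -
  let ?N = "mat (Suc n) (Suc n) (\<lambda>(a, b). M (i + a) (cs ! b))"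
  have del: "mat_delete ?N 0 b = mat n n (\<lambda>(a, b'). M (Suc i + a) (remove1 (cs ! b) cs ! b'))"
    if b: "b < Suc n" for b
  proof (rule eq_matI)
    have r: "remove1 (cs ! b) cs = take b cs @ drop (Suc b) cs"
      using assms b by (intro remove1_nth) auto
    fix a c assume "a < dim_row (mat n n (\<lambda>(a, b'). M (Suc i + a) (remove1 (cs ! b) cs ! b')))"
      "c < dim_col (mat n n (\<lambda>(a, b'). M (Suc i + a) (remove1 (cs ! b) cs ! b')))"
    then show "mat_delete ?N 0 b $$ (a, c) =
        mat n n (\<lambda>(a, b'). M (Suc i + a) (remove1 (cs ! b) cs ! b')) $$ (a, c)"
      using assms b unfolding r by (auto simp: mat_delete_def nth_append)
  qed (auto simp: mat_delete_def)
  have "det ?N = (\<Sum>b<Suc n. ?N $$ (0, b) * cofactor ?N 0 b)"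
    by (rule laplace_expansion_row) auto
  also have "\<dots> = (\<Sum>b<Suc n. (- 1) ^ index_of (cs ! b) cs * M i (cs ! b) *
      det (mat n n (\<lambda>(a, b'). M (Suc i + a) (remove1 (cs ! b) cs ! b'))))"
    using assms by (intro sum.cong refl) (simp add: cofactor_def del index_of_nth mult_ac)
  also have "\<dots> = (\<Sum>j\<in>set cs. (- 1) ^ index_of j cs * M i j *
      det (mat n n (\<lambda>(a, b). M (Suc i + a) (remove1 j cs ! b))))"
  proof (rule sum.reindex_bij_betw)
    show "bij_betw ((!) cs) {..<Suc n} (set cs)"
      using bij_betw_nth[OF assms(1) refl refl] assms(2) by simp
  qed
  finally show ?thesis .
qed

lemma terms_poly_append: "terms_poly n (S @ T) = terms_poly n S + terms_poly n T"
  by (simp add: terms_poly_def)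

lemma terms_poly_concat:
  "terms_poly n (concat (map f xs)) = (\<Sum>x\<leftarrow>xs. terms_poly n (f x))"
  by (induction xs) (simp_all add: terms_poly_append, simp add: terms_poly_def)

lemma terms_poly_same:
  assumes "\<And>m w. (m, w) \<in> set T \<Longrightarrow> m \<le> n"
  shows "terms_poly (Suc n) (map (apsnd ((*) c)) T) = Polynomial.smult c ([:0, 1:] * terms_poly n T)"
  using assms
proof (induction T)
  case (Cons t T)
  obtain m w where t: "t = (m, w)" by fastforce
  have "m \<le> n" using Cons.prems t by auto
  then have "monom (c * w) (Suc n - m) = Polynomial.smult c ([:0, 1:] * monom w (n - m))"
    by (simp add: Suc_diff_le smult_monom monom_Suc)
  moreover have "terms_poly (Suc n) (map (apsnd ((*) c)) T) = Polynomial.smult c ([:0, 1:] * terms_poly n T)"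
    using Cons.IH Cons.prems by (meson list.set_intros(2))
  ultimately show ?case
    by (simp add: terms_poly_def t smult_add_right distrib_left del: mult_pCons_left)
qed (simp add: terms_poly_def)

lemma terms_poly_Suc:
  "terms_poly (Suc n) (map (map_prod Suc ((*) c)) T) = Polynomial.smult c (terms_poly n T)"
  by (induction T) (auto simp: terms_poly_def smult_add_right smult_monom)

lemma det_cover_terms:
  assumes "distinct cs" "length cs = length rs"
    and "\<And>k. k < length rs \<Longrightarrow> distinct (rs ! k)"
    and "\<And>k j. k < length rs \<Longrightarrow> j \<in> set cs \<Longrightarrow> B (i + k) j \<noteq> 0 \<Longrightarrow> j \<in> set (rs ! k)"
  shows "det (mat (length rs) (length rs) (\<lambda>(a, b). xI_minus B (i + a) (cs ! b))) =
    terms_poly (length rs) (cover_terms B rs i cs)"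
  using assms
proof (induction rs arbitrary: i cs)
  case Nil
  have "det (mat 0 0 (\<lambda>(a, b). xI_minus B (i + a) (cs ! b))) = 1" by (rule det_dim_zero) simp
  then show ?case by (simp add: terms_poly_def)
next
  case (Cons r rs)
  let ?n = "length rs"
  define d where "d j = det (mat ?n ?n (\<lambda>(a, b). xI_minus B (Suc i + a) (remove1 j cs ! b)))" for j
  define T where "T j = cover_terms B rs (Suc i) (remove1 j cs)" for j
  have d: "d j = terms_poly ?n (T j)" if j: "j \<in> set cs" for j
  proof -
    have "distinct (remove1 j cs)" "length (remove1 j cs) = ?n"
      "\<And>k. k < ?n \<Longrightarrow> distinct (rs ! k)"
      "\<And>k j'. k < ?n \<Longrightarrow> j' \<in> set (remove1 j cs) \<Longrightarrow> B (Suc i + k) j' \<noteq> 0 \<Longrightarrow> j' \<in> set (rs ! k)"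
      using Cons.prems(1,2) j Cons.prems(3)[of "Suc k" for k] Cons.prems(4)[of "Suc k" for k]
      by (auto simp: length_remove1)
    then show ?thesis unfolding d_def T_def by (rule Cons.IH)
  qed
  let ?s = "\<lambda>j. (- 1) ^ index_of j cs :: real"
  have sg: "(- 1) ^ k * p = Polynomial.smult ((- 1) ^ k) p" for k and p :: "real poly"
    by (induction k) auto
  have "det (mat (Suc ?n) (Suc ?n) (\<lambda>(a, b). xI_minus B (i + a) (cs ! b)))
      = (\<Sum>j\<in>set cs. Polynomial.smult (?s j) (xI_minus B i j * d j))"
    using det_laplace_cols[of cs ?n "xI_minus B" i] Cons.prems(1,2)
    by (simp add: d_def mult.assoc sg)
  also have "\<dots> = (\<Sum>j\<in>set cs. (if j = i then Polynomial.smult (?s i) ([:0, 1:] * d i) else 0)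
      + Polynomial.smult (- ?s j * B i j) (d j))"
    by (intro sum.cong refl) (auto simp: xI_minus_def algebra_simps smult_diff_right)
  also have "\<dots> = (if i \<in> set cs then Polynomial.smult (?s i) ([:0, 1:] * d i) else 0)
      + (\<Sum>j\<in>set cs. Polynomial.smult (- ?s j * B i j) (d j))"
    by (simp only: sum.distrib sum.delta finite_set)
  also have "(\<Sum>j\<in>set cs. Polynomial.smult (- ?s j * B i j) (d j))
      = (\<Sum>j\<in>set r. if j \<in> set cs then Polynomial.smult (- ?s j * B i j) (d j) else 0)"
    using Cons.prems(4)[of 0]
    by (intro sum.mono_neutral_cong) auto
  also have "\<dots> = (\<Sum>j\<leftarrow>r. if j \<in> set cs then Polynomial.smult (- ?s j * B i j) (d j) else 0)"
    using Cons.prems(3)[of 0] by (simp add: sum_list_distinct_conv_sum_set)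
  also have "\<dots> = (\<Sum>j\<leftarrow>r. terms_poly (Suc ?n) (if j \<in> set cs then
      map (map_prod Suc ((*) ((- 1) ^ Suc (index_of j cs) * B i j))) (T j) else []))"
    by (intro arg_cong[where f = sum_list] map_cong refl) (auto simp: terms_poly_Suc d, simp add: terms_poly_def)
  also have "(if i \<in> set cs then Polynomial.smult (?s i) ([:0, 1:] * d i) else 0) =
      terms_poly (Suc ?n) (if i \<in> set cs then map (apsnd ((*) (?s i))) (T i) else [])"
    using cover_terms_size
    by (auto simp: d T_def terms_poly_same simp del: mult_pCons_left) (simp add: terms_poly_def)
  finally show ?case
    by (simp only: cover_terms.simps terms_poly_append terms_poly_concat T_def list.size add_Suc_right add_0_right)
qed

text \<open>On a sparse support there are few terms, against \<open>n!\<close> in the permutation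
  expansion; this lets the simplifier compute the coefficients with symbolic entries.\<close>

corollary char_poly_cover_terms:
  assumes "A \<in> carrier_mat n n" "length rs = n" "\<And>k. k < n \<Longrightarrow> distinct (rs ! k)"
    and "\<And>i j. i < n \<Longrightarrow> j < n \<Longrightarrow> A $$ (i, j) \<noteq> 0 \<Longrightarrow> j \<in> set (rs ! i)"
  shows "char_poly A = terms_poly n (cover_terms (\<lambda>i j. A $$ (i, j)) rs 0 [0..<n])"
proof -
  have "char_poly_matrix A = mat n n (\<lambda>(a, b). xI_minus (\<lambda>i j. A $$ (i, j)) (0 + a) ([0..<n] ! b))"
    by (rule eq_matI) (use assms(1) in \<open>auto simp: char_poly_matrix_def xI_minus_def\<close>)
  then show ?thesis
    unfolding char_poly_def using det_cover_terms[of "[0..<n]" rs "\<lambda>i j. A $$ (i, j)" 0] assms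
    by simp
qed

lemma coeff_terms_poly:
  assumes "\<And>m w. (m, w) \<in> set T \<Longrightarrow> m \<le> n" "k \<le> n"
  shows "coeff (terms_poly n T) (n - k) = (\<Sum>(m, w)\<leftarrow>T. if m = k then w else 0)"
  using assms
proof (induction T)
  case (Cons t T)
  obtain m w where t: "t = (m, w)" by fastforce
  have "m \<le> n" using Cons.prems t by auto
  then have "n - m = n - k \<longleftrightarrow> m = k" using Cons.prems by auto
  moreover have "coeff (terms_poly n T) (n - k) = (\<Sum>(m, w)\<leftarrow>T. if m = k then w else 0)"
    using Cons.IH Cons.prems by (meson list.set_intros(2))
  ultimately show ?case by (simp add: terms_poly_def t)
qed (simp add: terms_poly_def)

section \<open>A stable matrix with 11 nonzero entries\<close>

text \<open>\<open>u * cnj v = a * z * |v|^2 + w * cnj v\<close>, and \<open>w * cnj v\<close> is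
  conjugate to \<open>v * cnj w\<close>. In other words \<open>u / v\<close> lies in the closed
  right half-plane if \<open>v / w\<close> does, stated without division so that zeros need no
  separate treatment.\<close>

lemma routh_step:
  fixes z u v w :: complex
  assumes "Re z \<ge> 0" "Re (v * cnj w) \<ge> 0" "a \<ge> 0" "u = of_real a * z * v + w"
  shows "Re (u * cnj v) \<ge> 0"
proof -
  have "Re (u * cnj v) = a * Re z * ((Re v)\<^sup>2 + (Im v)\<^sup>2) + Re (v * cnj w)"
    by (simp add: assms(4) power2_eq_square algebra_simps)
  then show ?thesis using assms by simp
qed

text \<open>The chain \<open>r\<^sub>0, \<dots>, r\<^sub>6\<close> is the Routh scheme of the odd and the even part.\<close>

lemma hurwitz_example: "hurwitz [:1, 1, 6, 5, 9, 6, 3, 1:]"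
  unfolding hurwitz_def
proof (intro allI impI, rule ccontr)
  fix z :: complex
  assume root: "poly (map_poly complex_of_real [:1, 1, 6, 5, 9, 6, 3, 1:]) z = 0"
    and "\<not> Re z < 0"
  then have z: "Re z \<ge> 0" by simp
  define r0 where "r0 = z^7 + 6 * z^5 + 5 * z^3 + z"
  define r1 where "r1 = 3 * z^6 + 9 * z^4 + 6 * z^2 + 1"
  define r2 where "r2 = 3 * z^5 + 3 * z^3 + 2/3 * z"
  define r3 where "r3 = 6 * z^4 + 16/3 * z^2 + 1"
  define r4 where "r4 = 1/3 * z^3 + 1/6 * z"
  define r5 where "r5 = 7/3 * z^2 + 1"
  define r6 where "r6 = 1/42 * z"
  have e0: "r0 = of_real (1/3) * z * r1 + r2"
    by (simp add: r0_def r1_def r2_def algebra_simps eval_nat_numeral)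
  have e1: "r1 = of_real 1 * z * r2 + r3"
    by (simp add: r1_def r2_def r3_def algebra_simps eval_nat_numeral)
  have e2: "r2 = of_real (1/2) * z * r3 + r4"
    by (simp add: r2_def r3_def r4_def algebra_simps eval_nat_numeral)
  have e3: "r3 = of_real 18 * z * r4 + r5"
    by (simp add: r3_def r4_def r5_def algebra_simps eval_nat_numeral)
  have e4: "r4 = of_real (1/7) * z * r5 + r6"
    by (simp add: r4_def r5_def r6_def algebra_simps eval_nat_numeral)
  have e5: "r5 = of_real 98 * z * r6 + 1"
    by (simp add: r5_def r6_def algebra_simps eval_nat_numeral)
  have "Re (r6 * cnj 1) \<ge> 0" using z by (simp add: r6_def)
  then have "Re (r5 * cnj r6) \<ge> 0" by (rule routh_step[OF z _ _ e5]) simp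
  then have "Re (r4 * cnj r5) \<ge> 0" by (rule routh_step[OF z _ _ e4]) simp
  then have "Re (r3 * cnj r4) \<ge> 0" by (rule routh_step[OF z _ _ e3]) simp
  then have "Re (r2 * cnj r3) \<ge> 0" by (rule routh_step[OF z _ _ e2]) simp
  then have "Re (r1 * cnj r2) \<ge> 0" by (rule routh_step[OF z _ _ e1]) simp
  then have pos: "Re (r0 * cnj r1) \<ge> 0" by (rule routh_step[OF z _ _ e0]) simp
  have "r0 + r1 = 0"
    using root by (simp add: r0_def r1_def algebra_simps eval_nat_numeral)
  \<comment> \<open>Now \<open>pos\<close> reads \<open>- |r1|^2 \<ge> 0\<close>. So
    \<open>r0\<close> and \<open>r1\<close> vanish, and the chain carries this down to
    \<open>1 = 0\<close> in \<open>e5\<close>.\<close>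
  then have r0: "r0 = - r1" by (simp add: eq_neg_iff_add_eq_0)
  have "(Re r1)\<^sup>2 + (Im r1)\<^sup>2 \<le> 0" using pos by (simp add: r0 power2_eq_square)
  then have "r1 = 0" by (simp add: complex_eq_iff sum_power2_le_zero_iff)
  have "r0 = 0" using r0 \<open>r1 = 0\<close> by simp
  have "r2 = 0" using e0 \<open>r0 = 0\<close> \<open>r1 = 0\<close> by simp
  have "r3 = 0" using e1 \<open>r1 = 0\<close> \<open>r2 = 0\<close> by simp
  have "r4 = 0" using e2 \<open>r2 = 0\<close> \<open>r3 = 0\<close> by simp
  have "r5 = 0" using e3 \<open>r3 = 0\<close> \<open>r4 = 0\<close> by simp
  have "r6 = 0" using e4 \<open>r4 = 0\<close> \<open>r5 = 0\<close> by simp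
  show False using e5 \<open>r5 = 0\<close> \<open>r6 = 0\<close> by simp
qed

text \<open>Weigh a cycle by minus the product of its entries. The loops at 4 and 6, the 2-cycles
  \<open>0, 1\<close> and \<open>2, 6\<close> and the 6-cycle \<open>0, 2, 3, 4, 5, 1\<close> have
  weights 2, 1, 1, 3, 1. All are positive, so nothing cancels; the 6-cycle, alone or with the loop
  at 6, gives the sizes 6 and 7.\<close>

definition example_arcs :: "((nat \<times> nat) \<times> real) list" where
  "example_arcs = [((0, 1), 1), ((0, 2), 1), ((1, 0), - 1), ((2, 3), 1), ((2, 6), 1), ((3, 4), 1),
     ((4, 4), - 2), ((4, 5), 1), ((5, 1), 1), ((6, 2), - 3), ((6, 6), - 1)]"

definition example_mat :: "real mat" where
  "example_mat = mat 7 7 (\<lambda>e. case map_of example_arcs e of None \<Rightarrow> 0 | Some w \<Rightarrow> w)"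

lemma example_mat_carrier: "example_mat \<in> carrier_mat 7 7"
  by (simp add: example_mat_def)

lemma example_mat_nonzero:
  "i < 7 \<Longrightarrow> j < 7 \<Longrightarrow> example_mat $$ (i, j) \<noteq> 0 \<longleftrightarrow> (i, j) \<in> fst ` set example_arcs"
proof -
  assume "i < 7" "j < 7"
  then have entry: "example_mat $$ (i, j) = (case map_of example_arcs (i, j) of None \<Rightarrow> 0 | Some w \<Rightarrow> w)"
    by (simp add: example_mat_def)
  show ?thesis
  proof (cases "map_of example_arcs (i, j)")
    case None
    then have "(i, j) \<notin> fst ` set example_arcs" by (simp add: map_of_eq_None_iff)
    then show ?thesis using entry None by simp
  next
    case (Some w)
    then have w: "((i, j), w) \<in> set example_arcs" by (rule map_of_SomeD)
    then have "w \<noteq> 0" by (auto simp: example_arcs_def)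
    then show ?thesis using entry Some w by force
  qed
qed

lemma stable_example_mat: "stable example_mat"
proof -
  let ?rs = "[[1, 2], [0], [3, 6], [4], [4, 5], [1], [2, 6]] :: nat list list"
  have supp: "j \<in> set (?rs ! i)" if "i < 7" "j < 7" "example_mat $$ (i, j) \<noteq> 0" for i j
  proof -
    have "(i, j) \<in> fst ` set example_arcs" using that example_mat_nonzero by blast
    then show ?thesis by (auto simp: example_arcs_def)
  qed
  have "distinct (?rs ! k)" if "k < 7" for k
    using that by (auto simp: nth_Cons split: nat.split)
  define B where "B = (\<lambda>i j. example_mat $$ (i, j))"
  \<comment> \<open>Rows appear as iterated \<open>Suc\<close> because the recursion of
    \<open>cover_terms\<close> counts them that way; columns come from \<open>?rs\<close>.\<close>
  have entries:
    "B (0) (Suc 0) = 1"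
    "B (0) 2 = 1"
    "B (Suc 0) 0 = - 1"
    "B (Suc (Suc 0)) 3 = 1"
    "B (Suc (Suc 0)) 6 = 1"
    "B (Suc (Suc (Suc 0))) 4 = 1"
    "B (Suc (Suc (Suc (Suc 0)))) 4 = - 2"
    "B (Suc (Suc (Suc (Suc 0)))) 5 = 1"
    "B (Suc (Suc (Suc (Suc (Suc 0))))) (Suc 0) = 1"
    "B (Suc (Suc (Suc (Suc (Suc (Suc 0)))))) 2 = - 3"
    "B (Suc (Suc (Suc (Suc (Suc (Suc 0)))))) 6 = - 1"
    by (simp_all add: B_def example_mat_def example_arcs_def)
  have "char_poly example_mat = terms_poly 7 (cover_terms B ?rs 0 [0..<7])"
    unfolding B_def using \<open>\<And>k. k < 7 \<Longrightarrow> distinct (?rs ! k)\<close>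
    by (intro char_poly_cover_terms example_mat_carrier supp) auto
  also have "cover_terms B ?rs 0 [0..<7] =
      [(0, 1), (1, 1), (1, 2), (2, 2), (2, 3), (3, 6), (2, 1), (3, 1), (3, 2), (4, 2), (4, 3), (5, 6),
       (6, 1), (7, 1)]"
    by (simp add: upt_rec entries)
  also have "terms_poly 7 \<dots> = [:1, 1, 6, 5, 9, 6, 3, 1:]"
    by (simp add: terms_poly_def monom_Suc monom_0 numeral_eq_Suc)
  finally show ?thesis
    using stable_hurwitz[OF example_mat_carrier] hurwitz_example by simp
qed

section \<open>Irreducibility as strong connectivity, for matrices and sign patterns\<close>

lemma irreducible_matI:
  assumes A: "A \<in> carrier_mat n n"
    and conn: "\<And>X. X \<subset> {..<n} \<Longrightarrow> X \<noteq> {} \<Longrightarrow> \<exists>x\<in>X. \<exists>y\<in>{..<n} - X. A $$ (x, y) \<noteq> 0"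
  shows "irreducible_mat n A"
  unfolding irreducible_mat_def
proof (rule notI, elim exE conjE)
  fix p k A11 A12 A22
  assume p: "p permutes {..<n}" and k: "1 \<le> k" "k < n"
    and "A11 \<in> carrier_mat k k" "A12 \<in> carrier_mat (n - k) k" "A22 \<in> carrier_mat (n - k) (n - k)"
    and eq: "permute_mat n p A = four_block_mat A11 (0\<^sub>m k (n - k)) A12 A22"
  have zero: "A $$ (p i, p j) = 0" if "i < k" "k \<le> j" "j < n" for i j
  proof -
    have "permute_mat n p A $$ (i, j) = 0"
      unfolding eq using that k \<open>A11 \<in> _\<close> \<open>A12 \<in> _\<close> \<open>A22 \<in> _\<close> by simp
    then show ?thesis using that k by (simp add: permute_mat_def)
  qed
  have inj: "inj p" using p by (rule permutes_inj)
  have im: "p ` {..<n} = {..<n}" using p by (rule permutes_image)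
  have "card (p ` {..<k}) = k" using inj by (simp add: card_image inj_on_subset)
  then have "p ` {..<k} \<noteq> {..<n}" using k by auto
  moreover have "p ` {..<k} \<subseteq> {..<n}" using k image_mono[of "{..<k}" "{..<n}" p] im by auto
  ultimately have "p ` {..<k} \<subset> {..<n}" by blast
  moreover have "p ` {..<k} \<noteq> {}" using k by (auto simp: lessThan_empty_iff)
  ultimately have "\<exists>x\<in>p ` {..<k}. \<exists>y\<in>{..<n} - p ` {..<k}. A $$ (x, y) \<noteq> 0" by (rule conn)
  then obtain i y where iy: "i < k" "y < n" "y \<notin> p ` {..<k}" "A $$ (p i, y) \<noteq> 0"
    by auto
  obtain j where "j < n" "y = p j" using iy(2) im by (metis imageE lessThan_iff)
  then show False using zero[of i j] iy by fastforce
qed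

text \<open>If no arc left \<open>X\<close>, a permutation listing \<open>X\<close> before its
  complement would produce the zero block.\<close>

lemma irreducible_matD:
  assumes A: "A \<in> carrier_mat n n" and irr: "irreducible_mat n A"
    and X: "X \<subset> {..<n}" "X \<noteq> {}"
  shows "\<exists>x\<in>X. \<exists>y\<in>{..<n} - X. A $$ (x, y) \<noteq> 0"
proof (rule ccontr)
  assume no: "\<not> ?thesis"
  let ?k = "card X"
  have fin: "finite X" using X finite_subset by blast
  have k: "1 \<le> ?k" "?k < n"
    using X fin psubset_card_mono[OF _ X(1)] by (auto simp: Suc_le_eq card_gt_0_iff)
  have Y: "card ({..<n} - X) = card {?k..<n}" using X fin by (simp add: card_Diff_subset)
  obtain f where f: "bij_betw f {..<?k} X"
    using fin by (metis card_lessThan finite_lessThan finite_same_card_bij)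
  obtain g where g: "bij_betw g {?k..<n} ({..<n} - X)"
    using Y by (metis finite_Diff finite_atLeastLessThan finite_lessThan finite_same_card_bij)
  define p where "p i = (if i < ?k then f i else if i < n then g i else i)" for i
  have pf: "bij_betw p {..<?k} X" 
    using f by (rule bij_betw_cong[THEN iffD1, rotated]) (simp add: p_def)
  have pg: "bij_betw p {?k..<n} ({..<n} - X)"
    using g by (rule bij_betw_cong[THEN iffD1, rotated]) (simp add: p_def)
  have "bij_betw p ({..<?k} \<union> {?k..<n}) (X \<union> ({..<n} - X))"
    by (rule bij_betw_combine[OF pf pg]) auto
  moreover have "{..<?k} \<union> {?k..<n} = {..<n}" "X \<union> ({..<n} - X) = {..<n}" using k X by auto
  ultimately have p: "p permutes {..<n}"
    using k by (intro bij_imp_permutes) (auto simp: p_def)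
  have zero: "A $$ (p i, p j) = 0" if "i < ?k" "?k \<le> j" "j < n" for i j
    using no bij_betw_apply[OF pf, of i] bij_betw_apply[OF pg, of j] that by auto
  let ?B = "permute_mat n p A"
  define M11 M12 M22 where "M11 = mat ?k ?k (\<lambda>(i, j). ?B $$ (i, j))"
    and "M12 = mat (n - ?k) ?k (\<lambda>(i, j). ?B $$ (i + ?k, j))"
    and "M22 = mat (n - ?k) (n - ?k) (\<lambda>(i, j). ?B $$ (i + ?k, j + ?k))"
  note M = M11_def M12_def M22_def
  have "?B = four_block_mat M11 (0\<^sub>m ?k (n - ?k)) M12 M22"
    by (rule eq_matI) (use k zero in \<open>auto simp: permute_mat_def M\<close>)
  then have "\<not> irreducible_mat n A"
    unfolding irreducible_mat_def not_not using p k
    by (intro exI[of _ p] exI[of _ ?k] exI[of _ M11] exI[of _ M12] exI[of _ M22] conjI) (simp_all add: M)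
  then show False using irr by simp
qed

lemma irreducible_sign_pattern:
  assumes "A \<in> carrier_mat n n"
  shows "irreducible_mat n (sign_pattern A) \<longleftrightarrow> irreducible_mat n A"
proof -
  have S: "sign_pattern A \<in> carrier_mat n n" using assms by (simp add: sign_pattern_def)
  have nz: "sign_pattern A $$ (x, y) \<noteq> 0 \<longleftrightarrow> A $$ (x, y) \<noteq> 0" if "x < n" "y < n" for x y
    using assms that by (simp add: sign_pattern_def sign_of_def zero_sign_entry_def)
  have "irreducible_mat n (sign_pattern A)" if "irreducible_mat n A"
  proof (rule irreducible_matI[OF S])
    fix X assume X: "X \<subset> {..<n}" "X \<noteq> {}"
    then show "\<exists>x\<in>X. \<exists>y\<in>{..<n} - X. sign_pattern A $$ (x, y) \<noteq> 0"
      using irreducible_matD[OF assms that X] nz by blast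
  qed
  moreover have "irreducible_mat n A" if "irreducible_mat n (sign_pattern A)"
  proof (rule irreducible_matI[OF assms])
    fix X assume X: "X \<subset> {..<n}" "X \<noteq> {}"
    then show "\<exists>x\<in>X. \<exists>y\<in>{..<n} - X. A $$ (x, y) \<noteq> 0"
      using irreducible_matD[OF S that X] nz by blast
  qed
  ultimately show ?thesis by blast
qed

lemma num_nonzero_sign_pattern: "num_nonzero (sign_pattern A) = num_nonzero A"
proof -
  have "{(i, j). i < dim_row A \<and> j < dim_col A \<and> sign_pattern A $$ (i, j) \<noteq> 0} =
      {(i, j). i < dim_row A \<and> j < dim_col A \<and> A $$ (i, j) \<noteq> 0}"
    by (auto simp: sign_pattern_def sign_of_def zero_sign_entry_def split: if_splits)
  then show ?thesis by (simp add: num_nonzero_def sign_pattern_def)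
qed

lemma num_nonzero_example_mat: "num_nonzero example_mat = 11"
proof -
  have "{(i, j). i < 7 \<and> j < 7 \<and> example_mat $$ (i, j) \<noteq> 0} = fst ` set example_arcs"
  proof (intro equalityI subsetI)
    fix e assume "e \<in> fst ` set example_arcs"
    moreover then have "fst e < 7" "snd e < 7" by (auto simp: example_arcs_def)
    ultimately show "e \<in> {(i, j). i < 7 \<and> j < 7 \<and> example_mat $$ (i, j) \<noteq> 0}"
      using example_mat_nonzero[of "fst e" "snd e"] by (simp add: case_prod_unfold)
  next
    fix e assume "e \<in> {(i, j). i < 7 \<and> j < 7 \<and> example_mat $$ (i, j) \<noteq> 0}"
    then show "e \<in> fst ` set example_arcs"
      using example_mat_nonzero[of "fst e" "snd e"] by (simp add: case_prod_unfold)
  qed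
  then show ?thesis using example_mat_carrier by (simp add: num_nonzero_def example_arcs_def)
qed

text \<open>The example contains the closed walk \<open>0, 2, 3, 4, 5, 1, 0\<close> and the cycle \<open>2, 6, 2\<close>.\<close>

lemma irreducible_example_mat: "irreducible_mat 7 example_mat"
proof (rule irreducible_matI[OF example_mat_carrier], rule ccontr)
  fix X :: "nat set"
  assume X: "X \<subset> {..<7}" "X \<noteq> {}"
    and no: "\<not> (\<exists>x\<in>X. \<exists>y\<in>{..<7} - X. example_mat $$ (x, y) \<noteq> 0)"
  have step: "y \<in> X" if "x \<in> X" "(x, y) \<in> fst ` set example_arcs" for x y
  proof -
    have "x < 7" "y < 7" using that(2) by (auto simp: example_arcs_def)
    then show ?thesis using that no example_mat_nonzero by blast
  qed
  have arcs: "0 \<in> X \<Longrightarrow> 2 \<in> X" "2 \<in> X \<Longrightarrow> 3 \<in> X" "3 \<in> X \<Longrightarrow> 4 \<in> X" "4 \<in> X \<Longrightarrow> 5 \<in> X" "5 \<in> X \<Longrightarrow> 1 \<in> X"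
    "1 \<in> X \<Longrightarrow> 0 \<in> X" "2 \<in> X \<Longrightarrow> 6 \<in> X" "6 \<in> X \<Longrightarrow> 2 \<in> X"
    by (erule step, simp add: example_arcs_def)+
  have all: "x = 0 \<or> x = 1 \<or> x = 2 \<or> x = 3 \<or> x = 4 \<or> x = 5 \<or> x = 6" if "x < 7" for x :: nat
    using that by auto
  obtain x where "x \<in> X" using X(2) by blast
  moreover have "x < 7" using X(1) \<open>x \<in> X\<close> by auto
  ultimately have "0 \<in> X" using all[of x] arcs by blast
  then have "{0, 1, 2, 3, 4, 5, 6} \<subseteq> X" using arcs by blast
  then have "{..<7} \<subseteq> X" using all by auto
  then show False using X(1) by blast
qed

section \<open>Cycle covers of prescribed sizes\<close>

text \<open>The combinatorial shadow of \<open>cover_terms\<close>: weights are dropped, the columns already taken are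
  marked in \<open>used\<close>, and each cover records the rows it uses. The loops are left out, so that one
  evaluation serves all positions of the loops.\<close>

fun covers :: "nat list list \<Rightarrow> nat \<Rightarrow> bool list \<Rightarrow> (nat \<times> bool list) list" where
  "covers [] i used = [(0, [])]"
| "covers (r # rs) i used =
    (if used ! i then [] else map (map_prod id ((#) False)) (covers rs (Suc i) (used[i := True]))) @
    concat (map (\<lambda>j. if used ! j then [] else
      map (map_prod Suc ((#) True)) (covers rs (Suc i) (used[j := True]))) r)"

definition succ_lists :: "nat \<Rightarrow> (nat \<times> nat) list \<Rightarrow> nat list list" where
  "succ_lists n P = map (\<lambda>i. map snd (filter (\<lambda>e. fst e = i) P)) [0..<n]"

lemma in_succ_lists: "i < n \<Longrightarrow> j \<in> set (succ_lists n P ! i) \<longleftrightarrow> (i, j) \<in> set P"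
  by (force simp: succ_lists_def)

lemma distinct_succ_lists: "distinct P \<Longrightarrow> i < n \<Longrightarrow> distinct (succ_lists n P ! i)"
  by (auto simp: succ_lists_def distinct_map intro!: inj_onI prod_eqI)

definition free_loops :: "nat set \<Rightarrow> nat \<Rightarrow> bool list \<Rightarrow> nat set" where
  "free_loops L i S = {k. k < length S \<and> i + k \<in> L \<and> \<not> S ! k}"

lemma card_free_loops_Cons:
  "card (free_loops L i (b # S)) = (if i \<in> L \<and> \<not> b then 1 else 0) + card (free_loops L (Suc i) S)"
proof -
  have "free_loops L i (b # S) = (if i \<in> L \<and> \<not> b then {0} else {}) \<union> Suc ` free_loops L (Suc i) S"
    by (auto simp: free_loops_def image_iff less_Suc_eq_0_disj nth_Cons' gr0_conv_Suc)
  moreover have "finite (free_loops L (Suc i) S)" by (simp add: free_loops_def)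
  ultimately show ?thesis by (auto simp: card_image card_insert_if)
qed

text \<open>Dropping the loops from a cover leaves a cover of the loop-free digraph, and each
  dropped loop sits at a row which the latter leaves free. Conversely free loops can be added one at
  a time, so only the interval of sizes is recorded.\<close>

lemma cover_terms_covers:
  assumes "(m, w) \<in> set (cover_terms B rs' i cs)" "length rs' = length rs"
    and "\<And>k. k < length rs \<Longrightarrow> set (rs' ! k) \<subseteq> set (rs ! k) \<union> (if i + k \<in> L then {i + k} else {})"
    and "i + length rs \<le> length used" "distinct cs" "set cs \<subseteq> {..<length used}"
    and "\<And>j. j < length used \<Longrightarrow> used ! j \<longleftrightarrow> j \<notin> set cs"
  shows "\<exists>(m', S) \<in> set (covers rs i used). length S = length rs \<and> m' \<le> m \<and>
           m \<le> m' + card (free_loops L i S)"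
  using assms
proof (induction rs arbitrary: rs' i cs used m w)
  case Nil
  then show ?case by simp
next
  case (Cons r rs)
  obtain r' rs'' where rs': "rs' = r' # rs''" "length rs'' = length rs"
    using Cons.prems(2) by (cases rs') auto
  have IH: "\<exists>(m', S) \<in> set (covers rs (Suc i) (used[j := True])). length S = length rs \<and> m' \<le> m \<and>
           m \<le> m' + card (free_loops L (Suc i) S)"
    if "(m, w) \<in> set (cover_terms B rs'' (Suc i) (remove1 j cs))" "j \<in> set cs" for m w j
  proof (rule Cons.IH[OF that(1) rs'(2)])
    show "set (rs'' ! k) \<subseteq> set (rs ! k) \<union> (if Suc i + k \<in> L then {Suc i + k} else {})"
      if "k < length rs" for k
      using Cons.prems(3)[of "Suc k"] that by (auto simp: rs' split: if_splits)
    show "Suc i + length rs \<le> length (used[j := True])" "distinct (remove1 j cs)"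
      using Cons.prems(4,5) by auto
    show "set (remove1 j cs) \<subseteq> {..<length (used[j := True])}"
      using Cons.prems(6) by (auto dest: notin_set_remove1)
    show "used[j := True] ! j' \<longleftrightarrow> j' \<notin> set (remove1 j cs)"
      if "j' < length (used[j := True])" for j'
      using Cons.prems(5,7) that by (cases "j' = j") auto
  qed
  have used: "\<not> used ! j" if "j \<in> set cs" for j
    using Cons.prems(6,7) that by auto
  consider (skip) w' where "i \<in> set cs" "(m, w') \<in> set (cover_terms B rs'' (Suc i) (remove1 i cs))"
    | (arc) j m0 w' where "j \<in> set r'" "j \<in> set cs" "m = Suc m0"
        "(m0, w') \<in> set (cover_terms B rs'' (Suc i) (remove1 j cs))"
    using Cons.prems(1) by (auto simp: rs' split: if_splits)
  then show ?case
  proof cases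
    case skip
    then obtain m' S where S: "(m', S) \<in> set (covers rs (Suc i) (used[i := True]))"
      "length S = length rs" "m' \<le> m" "m \<le> m' + card (free_loops L (Suc i) S)"
      using IH by blast
    then have "(m', False # S) \<in> set (covers (r # rs) i used)"
      using used[OF skip(1)] by (force simp: image_iff)
    then show ?thesis using S by (intro bexI[of _ "(m', False # S)"]) (auto simp: card_free_loops_Cons)
  next
    case arc
    then obtain m' S where S: "(m', S) \<in> set (covers rs (Suc i) (used[j := True]))"
      "length S = length rs" "m' \<le> m0" "m0 \<le> m' + card (free_loops L (Suc i) S)"
      using IH by blast
    show ?thesis
    proof (cases "j \<in> set r")
      case True
      then have "(Suc m', True # S) \<in> set (covers (r # rs) i used)"
        using used[OF arc(2)] S(1) by (force simp: image_iff)
      then show ?thesis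
        using S arc by (intro bexI[of _ "(Suc m', True # S)"]) (auto simp: card_free_loops_Cons)
    next
      case False
      then have j: "j = i" "i \<in> L"
        using Cons.prems(3)[of 0] arc(1) by (auto simp: rs' split: if_splits)
      then have "(m', False # S) \<in> set (covers (r # rs) i used)"
        using used[OF arc(2)] S(1) by (force simp: image_iff)
      then show ?thesis
        using S arc j by (intro bexI[of _ "(m', False # S)"]) (auto simp: card_free_loops_Cons)
    qed
  qed
qed

text \<open>The connectives are written with \<open>if\<close> because \<open>code_simp\<close> evaluates both arguments of a conjunction.\<close>

primrec lazy_all :: "('a \<Rightarrow> bool) \<Rightarrow> 'a list \<Rightarrow> bool" where
  "lazy_all p [] = True"
| "lazy_all p (x # xs) = (if p x then lazy_all p xs else False)"

primrec lazy_ex :: "('a \<Rightarrow> bool) \<Rightarrow> 'a list \<Rightarrow> bool" where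
  "lazy_ex p [] = False"
| "lazy_ex p (x # xs) = (if p x then True else lazy_ex p xs)"

lemma lazy_all_iff: "lazy_all p xs \<longleftrightarrow> (\<forall>x\<in>set xs. p x)"
  by (induction xs) auto

lemma lazy_ex_iff: "lazy_ex p xs \<longleftrightarrow> (\<exists>x\<in>set xs. p x)"
  by (induction xs) auto

text \<open>The sizes 1 and 2 are covered in every digraph considered below.\<close>

definition covers_all_sizes :: "(nat \<times> bool list) list \<Rightarrow> nat list \<Rightarrow> bool" where
  "covers_all_sizes C L = lazy_all (\<lambda>k. lazy_ex (\<lambda>(m, S).
     if m \<le> k then k \<le> m + length (filter (\<lambda>r. \<not> S ! r) L) else False) C) [7, 6, 5, 4, 3]"

text \<open>\<open>P\<close> and \<open>L\<close> only bound the support from above, so patterns may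
  contain surplus arcs or loops.\<close>

definition supported :: "real mat \<Rightarrow> (nat \<times> nat) list \<Rightarrow> nat list \<Rightarrow> bool" where
  "supported A P L \<longleftrightarrow> distinct P \<and> distinct L \<and> set L \<subseteq> {..<7} \<and> (\<forall>(i, j) \<in> set P. i \<noteq> j) \<and>
     (\<forall>i<7. \<forall>j<7. A $$ (i, j) \<noteq> 0 \<longrightarrow> (i, j) \<in> set P \<or> i = j \<and> i \<in> set L)"

text \<open>For a supported matrix this is the coefficient of \<open>x^(7 - k)\<close> in the
  characteristic polynomial, that is \<open>(-1)^k\<close> times the sum of the principal minors of
  size \<open>k\<close>, in a form that can be evaluated symbolically.\<close>

definition signed_minors :: "real mat \<Rightarrow> (nat \<times> nat) list \<Rightarrow> nat list \<Rightarrow> nat \<Rightarrow> real" where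
  "signed_minors A P L k = (\<Sum>(m, w)\<leftarrow>cover_terms (\<lambda>i j. A $$ (i, j))
     (succ_lists 7 (P @ map (\<lambda>r. (r, r)) L)) 0 [0..<7]. if m = k then w else 0)"

lemma signed_minors_stable:
  assumes A: "A \<in> carrier_mat 7 7" "stable A" and sup: "supported A P L"
  defines "a \<equiv> signed_minors A P L"
  shows "k \<le> 7 \<Longrightarrow> a k > 0" "a 3 < a 1 * a 2" "a 5 < a 1 * a 4" "a 7 < a 1 * a 6"
    "a 1 * a 4 < a 2 * a 3"
proof -
  let ?Q = "P @ map (\<lambda>r. (r, r)) L"
  let ?T = "cover_terms (\<lambda>i j. A $$ (i, j)) (succ_lists 7 ?Q) 0 [0..<7]"
  have len: "length (succ_lists 7 ?Q) = 7" by (simp add: succ_lists_def)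
  have "distinct ?Q" using sup by (auto simp: supported_def distinct_map inj_on_def)
  then have cp: "char_poly A = terms_poly 7 ?T"
    using sup by (intro char_poly_cover_terms[OF A(1) len])
      (auto simp: distinct_succ_lists in_succ_lists supported_def image_iff)
  have coeff: "a k = coeff (char_poly A) (7 - k)" if "k \<le> 7" for k
    unfolding cp a_def signed_minors_def
    using that cover_terms_size[where rs = "succ_lists 7 ?Q"] len
    by (subst coeff_terms_poly) auto
  have deg: "degree (char_poly A) = 7" "lead_coeff (char_poly A) = 1"
    using degree_monic_char_poly[OF A(1)] by auto
  have H: "hurwitz (char_poly A)" using A stable_hurwitz by blast
  note C = hurwitz_coeffs[OF H deg(2), unfolded deg(1)]
  have a0: "a 0 = 1" using coeff[of 0] deg by simp
  show "k \<le> 7 \<Longrightarrow> a k > 0" using C(1) coeff by simp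
  \<comment> \<open>The minor at \<open>(i, j)\<close> compares \<open>a (8 - i) * a (6 - j)\<close>
    with \<open>a (7 - i) * a (7 - j)\<close>; choosing \<open>j = 6\<close> brings in
    \<open>a 0 = 1\<close>.\<close>
  show "a 3 < a 1 * a 2" using C(2)[of 5 6] a0 by (simp add: coeff mult_ac)
  show "a 5 < a 1 * a 4" using C(2)[of 3 6] a0 by (simp add: coeff mult_ac)
  show "a 7 < a 1 * a 6" using C(2)[of 1 6] a0 by (simp add: coeff mult_ac)
  show "a 1 * a 4 < a 2 * a 3" using C(2)[of 4 5] by (simp add: coeff mult_ac)
qed

text \<open>A positive coefficient cannot be an empty sum, whatever the weights are.\<close>

lemma stable_covers_all_sizes:
  assumes A: "A \<in> carrier_mat 7 7" "stable A" and sup: "supported A P L"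
  shows "covers_all_sizes (covers (succ_lists 7 P) 0 (replicate 7 False)) L"
  unfolding covers_all_sizes_def lazy_all_iff lazy_ex_iff
proof
  let ?Q = "P @ map (\<lambda>r. (r, r)) L"
  let ?T = "cover_terms (\<lambda>i j. A $$ (i, j)) (succ_lists 7 ?Q) 0 [0..<7]"
  fix k :: nat assume "k \<in> set [7, 6, 5, 4, 3]"
  then have "signed_minors A P L k \<noteq> 0"
    using signed_minors_stable(1)[OF A sup, of k] by auto
  moreover have "(\<Sum>(m, w)\<leftarrow>T. if m = k then w else 0) = 0" if "\<nexists>w. (k, w) \<in> set T"
    for T :: "(nat \<times> real) list"
    using that by (induction T) auto
  ultimately have "\<exists>w. (k, w) \<in> set ?T" unfolding signed_minors_def by blast
  then obtain w where w: "(k, w) \<in> set ?T" ..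
  have "\<exists>(m', S) \<in> set (covers (succ_lists 7 P) 0 (replicate 7 False)).
      length S = length (succ_lists 7 P) \<and> m' \<le> k \<and> k \<le> m' + card (free_loops (set L) 0 S)"
    by (rule cover_terms_covers[OF w]) (auto simp: succ_lists_def)
  then obtain m S where S: "(m, S) \<in> set (covers (succ_lists 7 P) 0 (replicate 7 False))"
    "length S = 7" "m \<le> k" "k \<le> m + card (free_loops (set L) 0 S)"
    by (auto simp: succ_lists_def)
  have "free_loops (set L) 0 S = set (filter (\<lambda>r. \<not> S ! r) L)"
    using sup S(2) by (auto simp: free_loops_def supported_def)
  then have "card (free_loops (set L) 0 S) = length (filter (\<lambda>r. \<not> S ! r) L)"
    using sup distinct_card[of "filter (\<lambda>r. \<not> S ! r) L"] by (simp add: supported_def)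
  then show "\<exists>x\<in>set (covers (succ_lists 7 P) 0 (replicate 7 False)).
      case x of (m, S) \<Rightarrow> if m \<le> k then k \<le> m + length (filter (\<lambda>r. \<not> S ! r) L) else False"
    using S by auto
qed

section \<open>Ear decompositions\<close>

text \<open>A path from \<open>s\<close> to \<open>t\<close> through the \<open>a\<close> new vertices \<open>n, \<dots>, n + a - 1\<close>; a chord if \<open>a = 0\<close>.\<close>

definition ear :: "nat \<Rightarrow> nat \<Rightarrow> nat \<Rightarrow> nat \<Rightarrow> (nat \<times> nat) list" where
  "ear n a s t = zip (s # [n..<n + a]) ([n..<n + a] @ [t])"

lemma length_ear: "length (ear n a s t) = Suc a"
  by (simp add: ear_def)

lemma in_ear:
  "(i, j) \<in> set (ear n a s t) \<longleftrightarrow>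
     (\<exists>k\<le>a. (if k = 0 then s else n + k - 1) = i \<and> (if k = a then t else n + k) = j)"
proof -
  have nth: "(s # [n..<n + a]) ! k = (if k = 0 then s else n + k - 1)"
    "([n..<n + a] @ [t]) ! k = (if k = a then t else n + k)" if "k \<le> a" for k
    using that by (auto simp: nth_append nth_Cons')
  have "(i, j) \<in> set (ear n a s t) \<longleftrightarrow>
      (\<exists>k\<le>a. (s # [n..<n + a]) ! k = i \<and> ([n..<n + a] @ [t]) ! k = j)"
    by (simp add: ear_def in_set_zip less_Suc_eq_le conj_ac del: upt_Suc)
  then show ?thesis by (simp only: nth cong: conj_cong)
qed

definition strongly_connected_on :: "'a set \<Rightarrow> ('a \<times> 'a) set \<Rightarrow> bool" where
  "strongly_connected_on V E \<longleftrightarrow> (\<forall>X. X \<subset> V \<longrightarrow> X \<noteq> {} \<longrightarrow> (\<exists>x\<in>X. \<exists>y\<in>V - X. (x, y) \<in> E))"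

text \<open>Vertices of \<open>P\<close> are positions in \<open>vs\<close>, so partial ear
  decompositions of different digraphs become the same concrete list of arcs.\<close>

definition realizes :: "('a \<times> 'a) set \<Rightarrow> 'a list \<Rightarrow> (nat \<times> nat) list \<Rightarrow> bool" where
  "realizes E vs P \<longleftrightarrow> distinct vs \<and> distinct P \<and>
     (\<forall>(i, j)\<in>set P. i < length vs \<and> j < length vs \<and> (vs ! i, vs ! j) \<in> E)"

text \<open>Let \<open>R\<close> be the set of ends of simple paths from \<open>y\<close> avoiding
  \<open>X\<close>. Some arc leaves \<open>R\<close>; a head outside \<open>X\<close> would lie in
  \<open>R\<close> again, by truncating or extending the path, so the head is in
  \<open>X\<close>.\<close>

lemma return_path:
  assumes sc: "strongly_connected_on V E" and X: "X \<noteq> {}" "X \<subseteq> V" and y: "y \<in> V - X"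
  obtains xs t where "xs \<noteq> []" "hd xs = y" "distinct xs" "set xs \<subseteq> V - X"
    "successively (\<lambda>a b. (a, b) \<in> E) xs" "t \<in> X" "(last xs, t) \<in> E"
proof -
  define path where "path xs \<longleftrightarrow> xs \<noteq> [] \<and> hd xs = y \<and> distinct xs \<and> set xs \<subseteq> V - X \<and>
    successively (\<lambda>a b. (a, b) \<in> E) xs" for xs
  define R where "R = last ` Collect path"
  have yR: "y \<in> R" unfolding R_def by (rule image_eqI[of _ _ "[y]"]) (use y in \<open>auto simp: path_def\<close>)
  have RV: "R \<subseteq> V - X" unfolding R_def path_def using last_in_set by blast
  then have "R \<subset> V" using X by blast
  then obtain z w where zw: "z \<in> R" "w \<in> V - R" "(z, w) \<in> E"
    using sc yR unfolding strongly_connected_on_def by (metis empty_iff)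
  obtain xs where xs: "path xs" "z = last xs" using zw(1) by (auto simp: R_def)
  have "w \<in> X"
  proof (rule ccontr)
    assume "w \<notin> X"
    show False
    proof (cases "w \<in> set xs")
      case True
      then obtain us ws where us: "xs = us @ w # ws" by (meson split_list)
      then have "xs = (us @ [w]) @ ws" by simp
      moreover have "successively (\<lambda>a b. (a, b) \<in> E) (us @ [w])"
        using xs(1) calculation unfolding path_def by (metis successively_append_iff)
      ultimately have "path (us @ [w])" using xs(1)
        by (cases us) (auto simp: path_def successively_append_iff simp del: append_assoc)
      then have "w \<in> R" unfolding R_def by force
      then show False using zw by blast
    next
      case False
      then have "path (xs @ [w])"
        using xs zw \<open>w \<notin> X\<close> by (auto simp: path_def successively_append_iff)
      then have "w \<in> R" unfolding R_def by force
      then show False using zw by blast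
    qed
  qed
  then show ?thesis using that[of xs w] xs zw by (auto simp: path_def)
qed

lemma add_ear:
  assumes sc: "strongly_connected_on V E" and vs: "realizes E vs P" "set vs \<subseteq> V"
    and s: "s < length vs" and y: "(vs ! s, y) \<in> E" "y \<in> V - set vs"
  obtains xs t where "xs \<noteq> []" "t < length vs" "set (vs @ xs) \<subseteq> V"
    "realizes E (vs @ xs) (P @ ear (length vs) (length xs) s t)"
proof -
  have ne: "set vs \<noteq> {}" using s by auto
  obtain xs z where xs: "xs \<noteq> []" "hd xs = y" "distinct xs" "set xs \<subseteq> V - set vs"
    "successively (\<lambda>a b. (a, b) \<in> E) xs" "z \<in> set vs" "(last xs, z) \<in> E"
    by (rule return_path[OF sc ne vs(2) y(2)])
  obtain t where t: "t < length vs" "z = vs ! t" using xs(6) by (metis in_set_conv_nth)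
  let ?n = "length vs" and ?a = "length xs"
  have a: "?a > 0" using xs(1) by simp
  \<comment> \<open>The last conjunct, a new endpoint for every arc of the ear, makes the ear
    disjoint from \<open>P\<close>.\<close>
  have arcs: "i < ?n + ?a \<and> j < ?n + ?a \<and> ((vs @ xs) ! i, (vs @ xs) ! j) \<in> E \<and> (?n \<le> i \<or> ?n \<le> j)"
    if e: "(i, j) \<in> set (ear ?n ?a s t)" for i j
  proof -
    obtain k where "k \<le> ?a \<and> (if k = 0 then s else ?n + k - 1) = i \<and> (if k = ?a then t else ?n + k) = j"
      using e unfolding in_ear ..
    then have k: "k \<le> ?a" "i = (if k = 0 then s else ?n + k - 1)" "j = (if k = ?a then t else ?n + k)"
      by auto
    have i: "(vs @ xs) ! i = (if k = 0 then vs ! s else xs ! (k - 1))"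
      using k(2) s by (auto simp: nth_append)
    have j: "(vs @ xs) ! j = (if k = ?a then vs ! t else xs ! k)"
      using k t by (auto simp: nth_append)
    have "((vs @ xs) ! i, (vs @ xs) ! j) \<in> E"
    proof -
      consider "k = 0" | "k = ?a" | "0 < k" "k < ?a" using k(1) by linarith
      then show ?thesis
      proof cases
        case 1
        then show ?thesis unfolding i j using a y(1) xs(1,2) by (simp add: hd_conv_nth)
      next
        case 2
        then show ?thesis unfolding i j using a xs(1,7) t by (simp add: last_conv_nth)
      next
        case 3
        then show ?thesis unfolding i j
          using xs(5) by (auto simp: successively_conv_nth dest!: spec[of _ "k - 1"])
      qed
    qed
    moreover have "?n \<le> i \<or> ?n \<le> j"
    proof (cases "k = 0")
      case True
      then have "j = ?n" using k(3) a by (simp split: if_splits)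
      then show ?thesis by simp
    next
      case False
      then have "i = ?n + (k - 1)" using k(2) by simp
      then show ?thesis by simp
    qed
    ultimately show ?thesis using k s t a by (auto split: if_splits)
  qed
  have "distinct (s # [?n..<?n + ?a])" using s by simp
  then have "distinct (ear ?n ?a s t)" unfolding ear_def by (rule distinct_zipI1)
  moreover have "set P \<inter> set (ear ?n ?a s t) = {}"
    using arcs vs(1) by (fastforce simp: realizes_def)
  moreover have "i < ?n + ?a \<and> j < ?n + ?a \<and> ((vs @ xs) ! i, (vs @ xs) ! j) \<in> E"
    if "(i, j) \<in> set P" for i j
    using vs(1) that by (fastforce simp: realizes_def nth_append)
  ultimately have "realizes E (vs @ xs) (P @ ear ?n ?a s t)"
    using vs(1) xs(3,4) arcs by (auto simp: realizes_def)
  with that xs(1,4) t(1) vs(2) show ?thesis by auto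
qed

lemma exit_arc:
  assumes "strongly_connected_on V E" "set vs \<subseteq> V" "set vs \<noteq> V" "vs \<noteq> []"
  obtains s y where "s < length vs" "(vs ! s, y) \<in> E" "y \<in> V - set vs"
proof -
  have "set vs \<subset> V" "set vs \<noteq> {}" using assms by auto
  then obtain x y where "x \<in> set vs" "y \<in> V - set vs" "(x, y) \<in> E"
    using assms(1) unfolding strongly_connected_on_def by metis
  then show ?thesis using that by (metis in_set_conv_nth)
qed

lemma realizes_arcs:
  assumes "realizes E vs P"
  defines "f \<equiv> \<lambda>(i, j). (vs ! i, vs ! j)"
  shows "f ` set P \<subseteq> E \<inter> set vs \<times> set vs" "card (f ` set P) = length P"
proof -
  show "f ` set P \<subseteq> E \<inter> set vs \<times> set vs"
    using assms(1) by (fastforce simp: realizes_def f_def)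
  have bound: "i < length vs \<and> j < length vs" if "(i, j) \<in> set P" for i j
    using assms(1) that by (auto simp: realizes_def)
  have "distinct vs" using assms(1) by (simp add: realizes_def)
  then have "inj_on f (set P)"
    by (auto simp: inj_on_def f_def nth_eq_iff_index_eq dest!: bound)
  then show "card (f ` set P) = length P"
    using assms(1) by (simp add: card_image distinct_card realizes_def)
qed

lemma realizes_length_le:
  assumes "realizes E vs P" "finite E"
  shows "length P \<le> card E"
  using card_mono[OF assms(2), of "(\<lambda>(i, j). (vs ! i, vs ! j)) ` set P"] realizes_arcs[OF assms(1)]
  by auto

text \<open>Every vertex outside \<open>vs\<close> is the source of an arc, and one more arc leaves \<open>vs\<close>.\<close>

lemma realizes_length_less:
  assumes sc: "strongly_connected_on V E" and "finite E" "finite V"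
    and vs: "realizes E vs P" "set vs \<subseteq> V" "set vs \<noteq> V" "vs \<noteq> []"
  shows "length P + (card V - length vs) < card E"
proof -
  let ?F = "(\<lambda>(i, j). (vs ! i, vs ! j)) ` set P"
  obtain s y where sy: "s < length vs" "(vs ! s, y) \<in> E" "y \<in> V - set vs"
    using exit_arc[OF sc vs(2-4)] .
  have "\<exists>w. (v, w) \<in> E" if "v \<in> V" for v
  proof -
    have "V \<noteq> {v}" using vs(2-4) by (cases vs) auto
    then have "{v} \<subset> V" using that by auto
    then show ?thesis using sc unfolding strongly_connected_on_def by blast
  qed
  then obtain g where g: "\<And>v. v \<in> V \<Longrightarrow> (v, g v) \<in> E" by metis
  let ?G = "(\<lambda>v. (v, g v)) ` (V - set vs)"
  have F: "?F \<subseteq> E \<inter> set vs \<times> set vs" "card ?F = length P" using realizes_arcs[OF vs(1)] by auto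
  have G: "card ?G = card V - length vs"
    using vs(1,2) assms(3) by (simp add: card_image inj_on_def card_Diff_subset distinct_card realizes_def)
  have new: "(vs ! s, y) \<notin> ?F \<union> ?G" using F(1) sy by auto
  have "?F \<inter> ?G = {}" using F(1) by auto
  then have "card (?F \<union> ?G) = length P + (card V - length vs)"
    using F(2) G assms(3) by (subst card_Un_disjoint) auto
  then have "card (insert (vs ! s, y) (?F \<union> ?G)) = Suc (length P + (card V - length vs))"
    using new assms(3) by simp
  moreover have "?F \<subseteq> E" "?G \<subseteq> E" using F(1) g by blast+
  then have "insert (vs ! s, y) (?F \<union> ?G) \<subseteq> E" using sy(2) by blast
  then have "card (insert (vs ! s, y) (?F \<union> ?G)) \<le> card E" by (rule card_mono[OF assms(2)])
  ultimately show ?thesis by linarith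
qed

lemma realizes_all_arcs:
  assumes "realizes E vs P" "finite E" "card E \<le> length P" "(x, y) \<in> E"
  shows "\<exists>(i, j)\<in>set P. x = vs ! i \<and> y = vs ! j"
proof -
  have "(\<lambda>(i, j). (vs ! i, vs ! j)) ` set P = E"
    using realizes_arcs[OF assms(1)] assms(2,3) by (intro card_seteq) auto
  with assms(4) show ?thesis by auto
qed

lemma add_chord:
  assumes vs: "realizes E vs P" "finite E" "E \<subseteq> set vs \<times> set vs" "card E = Suc (length P)"
  obtains i j where "i < length vs" "j < length vs" "realizes E vs (P @ ear (length vs) 0 i j)"
proof -
  let ?F = "(\<lambda>(i, j). (vs ! i, vs ! j)) ` set P"
  have "?F \<noteq> E" using realizes_arcs(2)[OF vs(1)] vs(4) by auto
  then obtain x y where xy: "(x, y) \<in> E" "(x, y) \<notin> ?F" using realizes_arcs(1)[OF vs(1)] by fast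
  obtain i j where ij: "i < length vs" "j < length vs" "x = vs ! i" "y = vs ! j"
    using xy(1) vs(3) by (metis SigmaE2 in_mono in_set_conv_nth)
  have "(i, j) \<notin> set P" using xy(2) ij by force
  then show ?thesis
    using that[OF ij(1,2)] vs(1) ij xy(1) by (auto simp: realizes_def ear_def)
qed

section \<open>Exclusion of the sparse digraphs\<close>

text \<open>Vertices 0 and 1 carry the 2-cycle; by its symmetry the first ear may start at 0. For
  \<open>a = 5\<close> the second ear is a chord. The loop may be anywhere and is kept
  separate.\<close>

definition one_loop_pattern :: "nat \<Rightarrow> nat \<Rightarrow> nat \<Rightarrow> nat \<Rightarrow> (nat \<times> nat) list" where
  "one_loop_pattern a t u v = [(0, 1), (1, 0)] @ ear 2 a 0 t @ ear (2 + a) (5 - a) u v"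

text \<open>The closed ear at 0 is a cycle through a loop vertex, which fixes one loop at 0.\<close>

definition two_loop_pattern :: "nat \<Rightarrow> nat \<Rightarrow> nat \<Rightarrow> (nat \<times> nat) list" where
  "two_loop_pattern a u v = ear 1 a 0 0 @ ear (1 + a) (6 - a) u v"

text \<open>The one-loop digraphs whose cycle covers have all sizes, each with its loop vertex; the suffix
  lists the coefficients that a relation proved below expresses through the others.\<close>

definition survivors_3 :: "((nat \<times> nat) list \<times> nat) list" where
  "survivors_3 =
    [([(0, 1), (1, 0), (0, 2), (2, 3), (3, 1), (1, 4), (4, 5), (5, 6), (6, 0)], 2),
     ([(0, 1), (1, 0), (0, 2), (2, 3), (3, 1), (1, 4), (4, 5), (5, 6), (6, 0)], 3),
     ([(0, 1), (1, 0), (0, 2), (2, 3), (3, 1), (2, 4), (4, 5), (5, 6), (6, 2)], 3),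
     ([(0, 1), (1, 0), (0, 2), (2, 3), (3, 1), (3, 4), (4, 5), (5, 6), (6, 3)], 2),
     ([(0, 1), (1, 0), (0, 2), (2, 3), (3, 4), (4, 0), (3, 5), (5, 6), (6, 2)], 4),
     ([(0, 1), (1, 0), (0, 2), (2, 3), (3, 4), (4, 0), (4, 5), (5, 6), (6, 3)], 2),
     ([(0, 1), (1, 0), (0, 2), (2, 3), (3, 4), (4, 1), (1, 5), (5, 6), (6, 0)], 5),
     ([(0, 1), (1, 0), (0, 2), (2, 3), (3, 4), (4, 1), (1, 5), (5, 6), (6, 0)], 6),
     ([(0, 1), (1, 0), (0, 2), (2, 3), (3, 4), (4, 1), (3, 5), (5, 6), (6, 2)], 4),
     ([(0, 1), (1, 0), (0, 2), (2, 3), (3, 4), (4, 1), (4, 5), (5, 6), (6, 3)], 2),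
     ([(0, 1), (1, 0), (0, 2), (2, 3), (3, 4), (4, 5), (5, 0), (4, 6), (6, 2)], 5),
     ([(0, 1), (1, 0), (0, 2), (2, 3), (3, 4), (4, 5), (5, 0), (5, 6), (6, 3)], 2),
     ([(0, 1), (1, 0), (0, 2), (2, 3), (3, 4), (4, 5), (5, 1), (4, 6), (6, 2)], 5),
     ([(0, 1), (1, 0), (0, 2), (2, 3), (3, 4), (4, 5), (5, 1), (5, 6), (6, 3)], 2),
     ([(0, 1), (1, 0), (0, 2), (2, 3), (3, 4), (4, 5), (5, 6), (6, 0), (5, 2)], 6),
     ([(0, 1), (1, 0), (0, 2), (2, 3), (3, 4), (4, 5), (5, 6), (6, 0), (6, 3)], 2),
     ([(0, 1), (1, 0), (0, 2), (2, 3), (3, 4), (4, 5), (5, 6), (6, 1), (5, 2)], 6),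
     ([(0, 1), (1, 0), (0, 2), (2, 3), (3, 4), (4, 5), (5, 6), (6, 1), (6, 3)], 2)]"

definition survivors_5 :: "((nat \<times> nat) list \<times> nat) list" where
  "survivors_5 =
    [([(0, 1), (1, 0), (0, 2), (2, 3), (3, 0), (2, 4), (4, 5), (5, 6), (6, 2)], 3),
     ([(0, 1), (1, 0), (0, 2), (2, 3), (3, 0), (3, 4), (4, 5), (5, 6), (6, 3)], 2)]"

definition survivors_7 :: "((nat \<times> nat) list \<times> nat) list" where
  "survivors_7 =
    [([(0, 1), (1, 0), (0, 2), (2, 3), (3, 4), (4, 5), (5, 6), (6, 0), (4, 2)], 1),
     ([(0, 1), (1, 0), (0, 2), (2, 3), (3, 4), (4, 5), (5, 6), (6, 0), (5, 3)], 1),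
     ([(0, 1), (1, 0), (0, 2), (2, 3), (3, 4), (4, 5), (5, 6), (6, 0), (6, 4)], 1)]"

definition survivors_4 :: "((nat \<times> nat) list \<times> nat) list" where
  "survivors_4 =
    [([(0, 1), (1, 0), (0, 2), (2, 3), (3, 4), (4, 5), (5, 6), (6, 1), (4, 2)], 5),
     ([(0, 1), (1, 0), (0, 2), (2, 3), (3, 4), (4, 5), (5, 6), (6, 1), (4, 2)], 6),
     ([(0, 1), (1, 0), (0, 2), (2, 3), (3, 4), (4, 5), (5, 6), (6, 1), (5, 3)], 2),
     ([(0, 1), (1, 0), (0, 2), (2, 3), (3, 4), (4, 5), (5, 6), (6, 1), (5, 3)], 6),
     ([(0, 1), (1, 0), (0, 2), (2, 3), (3, 4), (4, 5), (5, 6), (6, 1), (6, 4)], 2),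
     ([(0, 1), (1, 0), (0, 2), (2, 3), (3, 4), (4, 5), (5, 6), (6, 1), (6, 4)], 3)]"

definition survivors_467 :: "((nat \<times> nat) list \<times> nat) list" where
  "survivors_467 =
    [([(0, 1), (1, 0), (0, 2), (2, 3), (3, 0), (3, 4), (4, 5), (5, 6), (6, 2)], 1)]"

definition survivors where "survivors = survivors_3 @ survivors_4 @ survivors_5 @ survivors_7 @ survivors_467"

definition covers_of :: "(nat \<times> nat) list \<Rightarrow> (nat \<times> bool list) list" where
  "covers_of P = covers (succ_lists 7 P) 0 (replicate 7 False)"

definition one_loop_check :: "nat \<Rightarrow> nat \<Rightarrow> nat \<Rightarrow> nat \<Rightarrow> bool" where
  "one_loop_check a t u v = (let P = one_loop_pattern a t u v; C = covers_of P in
     lazy_all (\<lambda>r. if covers_all_sizes C [r] then (P, r) \<in> set survivors else True) [0..<7])"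

definition one_loop_checks :: "nat \<Rightarrow> nat \<Rightarrow> bool" where
  "one_loop_checks a t = lazy_all (\<lambda>u. lazy_all (one_loop_check a t u) [0..<2 + a]) [0..<2 + a]"

definition two_loop_check :: "nat \<Rightarrow> nat \<Rightarrow> nat \<Rightarrow> bool" where
  "two_loop_check a u v = (let C = covers_of (two_loop_pattern a u v) in
     lazy_all (\<lambda>r. \<not> covers_all_sizes C [0, r]) [1..<7])"

definition two_loop_checks :: "nat \<Rightarrow> bool" where
  "two_loop_checks a = lazy_all (\<lambda>u. lazy_all (two_loop_check a u) [0..<1 + a]) [0..<1 + a]"

text \<open>Without loops a 7-cycle has only the empty and the full cover, so three loops miss the
  sizes 4 to 6. For \<open>r = r'\<close> a loop is counted twice, which does not fill the
  gap.\<close>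

definition three_loop_checks :: bool where
  "three_loop_checks = (let C = covers_of (ear 1 6 0 0) in
    lazy_all (\<lambda>r. lazy_all (\<lambda>r'. \<not> covers_all_sizes C [0, r, r']) [1..<7]) [1..<7])"

text \<open>The loop lies off the 2-cycle and there is no 3-cycle, so size 3 is covered only by
  these two together.\<close>

lemma identity_3:
  fixes A :: "real mat"
  assumes "(P, r) \<in> set survivors_3"
  defines "a \<equiv> signed_minors A P [r]"
  shows "a 3 = a 1 * a 2"
  using assms(1) unfolding a_def survivors_3_def list.set insert_iff empty_iff
  by - (elim disjE FalseE; simp add: signed_minors_def succ_lists_def upt_rec algebra_simps)
text \<open>The loop meets the 3-cycle but not the 4-cycle. Hence the 4-cycle alone gives
  \<open>a 4\<close>, and with the loop it gives \<open>a 5\<close>.\<close>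

lemma identity_5:
  fixes A :: "real mat"
  assumes "(P, r) \<in> set survivors_5"
  defines "a \<equiv> signed_minors A P [r]"
  shows "a 5 = a 1 * a 4"
  using assms(1) unfolding a_def survivors_5_def list.set insert_iff empty_iff
  by - (elim disjE FalseE; simp add: signed_minors_def succ_lists_def upt_rec algebra_simps)
text \<open>The 6-cycle misses only the loop vertex 1, and no other cover has size 6 or 7.\<close>

lemma identity_7:
  fixes A :: "real mat"
  assumes "(P, r) \<in> set survivors_7"
  defines "a \<equiv> signed_minors A P [r]"
  shows "a 7 = a 1 * a 6"
  using assms(1) unfolding a_def survivors_7_def list.set insert_iff empty_iff
  by - (elim disjE FalseE; simp add: signed_minors_def succ_lists_def upt_rec algebra_simps)
text \<open>The loop is disjoint from the 2-cycle and from the 3-cycle, so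
  \<open>a 3 - a 1 * a 2\<close> is the weight of the 3-cycle, and the 3-cycle with the loop is the
  only cover of size 4.\<close>

lemma identity_4:
  fixes A :: "real mat"
  assumes "(P, r) \<in> set survivors_4"
  defines "a \<equiv> signed_minors A P [r]"
  shows "a 4 = a 1 * (a 3 - a 1 * a 2)"
  using assms(1) unfolding a_def survivors_4_def list.set insert_iff empty_iff
  by - (elim disjE FalseE; simp add: signed_minors_def succ_lists_def upt_rec algebra_simps)
text \<open>The cycles have lengths 1, 2, 3 and 5. The disjoint pairs are the loop with the 3-cycle
  or the 5-cycle, and the 2-cycle with the 5-cycle.\<close>

lemma identity_467:
  fixes A :: "real mat"
  assumes "(P, r) \<in> set survivors_467"
  defines "a \<equiv> signed_minors A P [r]"
  shows "a 4 = a 1 * a 3 \<and> a 6 = a 1 * a 5 \<and> a 7 = a 2 * a 5"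
  using assms(1) unfolding a_def survivors_467_def list.set insert_iff empty_iff
  by - (elim disjE FalseE; simp add: signed_minors_def succ_lists_def upt_rec algebra_simps)

lemma one_loop_checks_1_0: "one_loop_checks 1 0" by code_simp
lemma one_loop_checks_1_1: "one_loop_checks 1 1" by code_simp
lemma one_loop_checks_2_0: "one_loop_checks 2 0" by code_simp
lemma one_loop_checks_2_1: "one_loop_checks 2 1" by code_simp
lemma one_loop_checks_3_0: "one_loop_checks 3 0" by code_simp
lemma one_loop_checks_3_1: "one_loop_checks 3 1" by code_simp
lemma one_loop_checks_4_0: "one_loop_checks 4 0" by code_simp
lemma one_loop_checks_4_1: "one_loop_checks 4 1" by code_simp
lemma one_loop_checks_5_0: "one_loop_checks 5 0" by code_simp
lemma one_loop_checks_5_1: "one_loop_checks 5 1" by code_simp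
lemma two_loop_checks_1: "two_loop_checks 1" by code_simp
lemma two_loop_checks_2: "two_loop_checks 2" by code_simp
lemma two_loop_checks_3: "two_loop_checks 3" by code_simp
lemma two_loop_checks_4: "two_loop_checks 4" by code_simp
lemma two_loop_checks_5: "two_loop_checks 5" by code_simp
lemma two_loop_checks_6: "two_loop_checks 6" by code_simp
lemma three_loop_checks: "three_loop_checks" by code_simp

lemma survivor_not_stable:
  assumes A: "A \<in> carrier_mat 7 7" "supported A P [r]" and r: "(P, r) \<in> set survivors"
  shows "\<not> stable A"
proof
  assume "stable A"
  define a where "a = signed_minors A P [r]"
  note S = signed_minors_stable[OF A(1) \<open>stable A\<close> A(2), folded a_def]
  have pos: "a 1 > 0" "a 2 > 0" "a 3 > 0" "a 4 > 0" "a 5 > 0" using S(1) by simp_all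
  consider "a 3 = a 1 * a 2" | "a 5 = a 1 * a 4" | "a 7 = a 1 * a 6" | "a 4 = a 1 * (a 3 - a 1 * a 2)"
    | "a 4 = a 1 * a 3" "a 6 = a 1 * a 5" "a 7 = a 2 * a 5"
    using r identity_3[of P r A] identity_4[of P r A] identity_5[of P r A] identity_7[of P r A]
      identity_467[of P r A]
    unfolding survivors_def a_def set_append Un_iff by blast
  then show False
  proof cases
    case 4
    have "a 1 * (a 3 - a 1 * a 2) < 0" using pos S(2) by (simp add: mult_less_0_iff)
    then show False using 4 pos by simp
  next
    case 5
    \<comment> \<open>The bound on \<open>a 7\<close> puts \<open>a 2\<close> below
      \<open>a 1 * a 1\<close>, while the bound on \<open>a 1 * a 4\<close> puts it above.\<close>
    have "a 2 * a 5 < (a 1 * a 1) * a 5" using S(4) 5 by (simp add: mult.assoc)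
    then have "a 2 < a 1 * a 1" using pos by (simp add: mult_less_cancel_right)
    moreover have "(a 1 * a 1) * a 3 < a 2 * a 3" using S(5) 5 by (simp add: mult.assoc)
    then have "a 1 * a 1 < a 2" using pos by (simp add: mult_less_cancel_right)
    ultimately show False by simp
  qed (use S in simp_all)
qed

lemma covers_of_all_sizes:
  "A \<in> carrier_mat 7 7 \<Longrightarrow> stable A \<Longrightarrow> supported A P L \<Longrightarrow> covers_all_sizes (covers_of P) L"
  unfolding covers_of_def by (rule stable_covers_all_sizes)

lemma one_loop_not_stable:
  assumes A: "A \<in> carrier_mat 7 7" "supported A (one_loop_pattern a t u v) [r]"
    and bounds: "1 \<le> a" "a \<le> 5" "t < 2" "u < 2 + a" "v < 2 + a" "r < 7"
  shows "\<not> stable A"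
proof
  assume st: "stable A"
  have "a \<in> {1, 2, 3, 4, 5}" "t \<in> {0, 1}" using bounds by auto
  then have "one_loop_checks a t"
    using one_loop_checks_1_0 one_loop_checks_1_1 one_loop_checks_2_0 one_loop_checks_2_1
      one_loop_checks_3_0 one_loop_checks_3_1 one_loop_checks_4_0 one_loop_checks_4_1
      one_loop_checks_5_0 one_loop_checks_5_1 by blast
  moreover have "u \<in> set [0..<2 + a]" "v \<in> set [0..<2 + a]" using bounds by auto
  ultimately have "one_loop_check a t u v" unfolding one_loop_checks_def lazy_all_iff by blast
  then have "(one_loop_pattern a t u v, r) \<in> set survivors"
    using covers_of_all_sizes[OF A(1) st A(2)] bounds
    by (auto simp: one_loop_check_def Let_def lazy_all_iff split: if_splits)
  then show False using survivor_not_stable[OF A] st by blast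
qed

lemma two_loop_not_stable:
  assumes A: "A \<in> carrier_mat 7 7" "supported A (two_loop_pattern a u v) [0, r]"
    and bounds: "1 \<le> a" "a \<le> 6" "u < 1 + a" "v < 1 + a" "1 \<le> r" "r < 7"
  shows "\<not> stable A"
proof
  assume st: "stable A"
  have "a \<in> {1, 2, 3, 4, 5, 6}" using bounds by auto
  then have "two_loop_checks a"
    using two_loop_checks_1 two_loop_checks_2 two_loop_checks_3 two_loop_checks_4 two_loop_checks_5
      two_loop_checks_6 by blast
  moreover have "u \<in> set [0..<1 + a]" "v \<in> set [0..<1 + a]" using bounds by auto
  ultimately have "two_loop_check a u v" unfolding two_loop_checks_def lazy_all_iff by blast
  then show False
    using covers_of_all_sizes[OF A(1) st A(2)] bounds by (simp add: two_loop_check_def Let_def lazy_all_iff)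
qed

lemma three_loop_not_stable:
  assumes A: "A \<in> carrier_mat 7 7" "supported A (ear 1 6 0 0) [0, r, r']"
    and bounds: "1 \<le> r" "r < 7" "1 \<le> r'" "r' < 7"
  shows "\<not> stable A"
  using covers_of_all_sizes[OF A(1) _ A(2)] bounds three_loop_checks
  by (auto simp: three_loop_checks_def Let_def lazy_all_iff)

section \<open>From a stable matrix to a labelled ear pattern\<close>

lemma char_poly_permute_mat:
  fixes A :: "'a::field mat"
  assumes p: "p permutes {..<n}" and A: "A \<in> carrier_mat n n"
  shows "char_poly (permute_mat n p A) = char_poly A"
proof -
  let ?P = "permutation_mat n p :: 'a mat"
  have P: "?P \<in> carrier_mat n n" by (simp add: permutation_mat_def)
  have p_less: "p i < n" if "i < n" for i using permutes_in_image[OF p, of i] that by simp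
  have "?P * ?P\<^sup>T = ?P * 1\<^sub>m n * ?P\<^sup>T" using P by simp
  also have "\<dots> = permute_mat n p (1\<^sub>m n)" by (rule permute_mat_eq_conjugation[OF p]) simp
  also have "\<dots> = 1\<^sub>m n"
    using p_less permutes_inj[OF p] by (intro eq_matI) (auto simp: permute_mat_def dest: injD)
  finally have 1: "?P * ?P\<^sup>T = 1\<^sub>m n" .
  then have 2: "?P\<^sup>T * ?P = 1\<^sub>m n" 
    by (rule mat_mult_left_right_inverse[OF P, rotated]) (use P in simp)
  have "similar_mat (permute_mat n p A) A"
    unfolding similar_mat_def
    by (intro exI, rule similar_mat_witI[OF 1 2 permute_mat_eq_conjugation[OF p A, symmetric]])
      (use A P in \<open>auto simp: permute_mat_def\<close>)
  then show ?thesis by (rule char_poly_similar)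
qed

text \<open>Expanding the product selects \<open>x\<close> or the constant from each factor;
  \<open>S\<close> collects the constants.\<close>

lemma prod_affine_coeff:
  fixes c :: "'b \<Rightarrow> 'a::comm_ring_1"
  assumes "finite I" "coeff (\<Prod>i\<in>I. (if F i then [:0, 1:] else 0) + [:c i:]) m \<noteq> 0"
  shows "\<exists>S\<subseteq>I. card (I - S) = m \<and> (\<forall>i\<in>I - S. F i) \<and> (\<forall>i\<in>S. c i \<noteq> 0)"
  using assms
proof (induction I arbitrary: m rule: finite_induct)
  case empty
  then show ?case by (simp split: if_splits)
next
  case (insert x I)
  let ?Q = "\<Prod>i\<in>I. (if F i then [:0, 1:] else 0) + [:c i:]"
  have "coeff (\<Prod>i\<in>insert x I. (if F i then [:0, 1:] else 0) + [:c i:]) m =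
      (if F x \<and> m > 0 then coeff ?Q (m - 1) else 0) + c x * coeff ?Q m"
    using insert.hyps by (cases m) (simp_all add: distrib_right)
  then consider "c x \<noteq> 0" "coeff ?Q m \<noteq> 0" | "F x" "m > 0" "coeff ?Q (m - 1) \<noteq> 0"
    using insert.prems by (cases "c x = 0"; cases "coeff ?Q m = 0") (auto split: if_splits)
  then show ?case
  proof cases
    case 1
    obtain S where S: "S \<subseteq> I" "card (I - S) = m" "\<forall>i\<in>I - S. F i" "\<forall>i\<in>S. c i \<noteq> 0"
      using insert.IH[OF 1(2)] by blast
    moreover have "insert x I - insert x S = I - S" using insert.hyps S(1) by auto
    ultimately show ?thesis using 1 by (intro exI[of _ "insert x S"]) auto
  next
    case 2
    obtain S where S: "S \<subseteq> I" "card (I - S) = m - 1" "\<forall>i\<in>I - S. F i" "\<forall>i\<in>S. c i \<noteq> 0"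
      using insert.IH[OF 2(3)] by blast
    moreover have "insert x I - S = insert x (I - S)" using insert.hyps S(1) by auto
    ultimately show ?thesis using 2 insert.hyps by (intro exI[of _ S]) auto
  qed
qed

text \<open>Supplies the loop and the 2-cycle from which the decomposition starts, before anything
  is known about the support.\<close>

lemma char_poly_coeff_cycle_cover:
  fixes A :: "'a::comm_ring_1 mat"
  assumes A: "A \<in> carrier_mat n n" and nz: "coeff (char_poly A) (n - k) \<noteq> 0" and k: "k \<le> n"
  shows "\<exists>p S. S \<subseteq> {..<n} \<and> card S = k \<and> p permutes S \<and> (\<forall>i\<in>S. A $$ (i, p i) \<noteq> 0)"
proof -
  let ?M = "char_poly_matrix A"
  have "char_poly A = (\<Sum>p | p permutes {0..<n}. signof p * (\<Prod>i = 0..<n. ?M $$ (i, p i)))"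
    unfolding char_poly_def by (rule det_def') (use A in simp)
  then have "(\<Sum>p | p permutes {0..<n}. coeff (signof p * (\<Prod>i = 0..<n. ?M $$ (i, p i))) (n - k)) \<noteq> 0"
    using nz by (simp add: coeff_sum)
  then obtain p where p: "p permutes {0..<n}" "coeff (signof p * (\<Prod>i = 0..<n. ?M $$ (i, p i))) (n - k) \<noteq> 0"
    by (metis (mono_tags, lifting) mem_Collect_eq sum.not_neutral_contains_not_neutral)
  have "coeff (\<Prod>i = 0..<n. ?M $$ (i, p i)) (n - k) \<noteq> 0"
    using p(2) by (cases p rule: sign_cases) auto
  moreover have "(\<Prod>i = 0..<n. ?M $$ (i, p i)) =
      (\<Prod>i = 0..<n. (if p i = i then [:0, 1:] else 0) + [:- A $$ (i, p i):])"
    using A permutes_in_image[OF p(1)] by (intro prod.cong refl) (auto simp: char_poly_matrix_def)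
  ultimately obtain S where S: "S \<subseteq> {0..<n}" "card ({0..<n} - S) = n - k"
      "\<forall>i\<in>{0..<n} - S. p i = i" "\<forall>i\<in>S. - A $$ (i, p i) \<noteq> 0"
    using prod_affine_coeff[of "{0..<n}" "\<lambda>i. p i = i" "\<lambda>i. - A $$ (i, p i)" "n - k"] by auto
  have "card S = k"
    using S(1,2) k card_mono[OF _ S(1)] by (simp add: card_Diff_subset finite_subset)
  moreover have "p permutes S"
    by (rule permutes_superset[OF p(1)]) (use S(3) in blast)
  ultimately show ?thesis using S by (intro exI[of _ p] exI[of _ S]) auto
qed

text \<open>Opposite in direction to \<open>realizes\<close>: here \<open>P\<close> must account for
  every arc of \<open>E\<close>, which is what \<open>supported\<close> asks for.\<close>

definition labels :: "(nat \<times> nat) set \<Rightarrow> nat list \<Rightarrow> (nat \<times> nat) list \<Rightarrow> bool" where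
  "labels E vs P \<longleftrightarrow> distinct vs \<and> set vs = {..<7} \<and> distinct P \<and>
     (\<forall>(i, j)\<in>set P. i \<noteq> j \<and> i < 7 \<and> j < 7) \<and>
     (\<forall>(x, y)\<in>E. \<exists>(i, j)\<in>set P. x = vs ! i \<and> y = vs ! j)"

lemma realizes_labels:
  assumes "realizes E vs P" "finite E" "set vs = {..<7}" "card E \<le> length P" "\<And>x. (x, x) \<notin> E"
  shows "labels E vs P"
proof -
  have "length vs = 7"
    using assms(1,3) distinct_card[of vs] by (simp add: realizes_def)
  then show ?thesis
    using assms(1,3,5) realizes_all_arcs[OF assms(1,2,4)]
    by (fastforce simp: labels_def realizes_def)
qed

lemma labels_index:
  assumes "labels E vs P" "x < 7"
  obtains l where "l < 7" "vs ! l = x"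
proof -
  have vs: "distinct vs" "set vs = {..<7}" using assms(1) by (auto simp: labels_def)
  then have "length vs = 7" using distinct_card[of vs] by simp
  moreover have "x \<in> set vs" using vs(2) assms(2) by simp
  ultimately show ?thesis using that by (metis in_set_conv_nth)
qed

lemma labels_supported:
  assumes A: "A \<in> carrier_mat 7 7" "stable A"
    and E: "labels {(i, j). i < 7 \<and> j < 7 \<and> i \<noteq> j \<and> A $$ (i, j) \<noteq> 0} vs P" (is "labels ?E vs P")
    and L: "distinct L" "set L \<subseteq> {..<7}" "{i. i < 7 \<and> A $$ (i, i) \<noteq> 0} \<subseteq> (!) vs ` set L"
  obtains B where "B \<in> carrier_mat 7 7" "stable B" "supported B P L"
proof -
  have vs: "distinct vs" "set vs = {..<7}" using E by (auto simp: labels_def)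
  then have len: "length vs = 7" using distinct_card[of vs] by simp
  define p where "p i = (if i < 7 then vs ! i else i)" for i
  have "bij_betw ((!) vs) {..<7} {..<7}" using bij_betw_nth[OF vs(1)] vs(2) len by simp
  then have "bij_betw p {..<7} {..<7}"
    by (rule bij_betw_cong[THEN iffD1, rotated]) (simp add: p_def)
  then have p: "p permutes {..<7}" by (rule bij_imp_permutes) (simp add: p_def)
  let ?B = "permute_mat 7 p A"
  have B: "?B \<in> carrier_mat 7 7" by (simp add: permute_mat_def)
  have "stable ?B"
    using A stable_hurwitz[OF B] stable_hurwitz[OF A(1)] char_poly_permute_mat[OF p A(1)] by simp
  moreover have "(i, j) \<in> set P \<or> i = j \<and> i \<in> set L"
    if ij: "i < 7" "j < 7" "?B $$ (i, j) \<noteq> 0" for i j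
  proof -
    have nz: "A $$ (vs ! i, vs ! j) \<noteq> 0" using ij by (simp add: permute_mat_def p_def)
    have less: "vs ! i < 7" "vs ! j < 7" using vs(2) len ij nth_mem by fastforce+
    show ?thesis
    proof (cases "i = j")
      case True
      then have "vs ! i \<in> (!) vs ` set L" using L(3) nz less by auto
      then obtain l where "l \<in> set L" "vs ! i = vs ! l" by auto
      then show ?thesis
        using True vs(1) len ij L(2) nth_eq_iff_index_eq[of vs i l] by auto
    next
      case False
      then have "(vs ! i, vs ! j) \<in> ?E" using nz less vs(1) len ij by (simp add: nth_eq_iff_index_eq)
      then obtain i' j' where P: "(i', j') \<in> set P" "vs ! i = vs ! i'" "vs ! j = vs ! j'"
        using E unfolding labels_def by blast
      then have "i' < 7" "j' < 7" using E by (auto simp: labels_def)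
      then have "i = i'" "j = j'"
        using P vs(1) len ij nth_eq_iff_index_eq by metis+
      then show ?thesis using P by simp
    qed
  qed
  then have "supported ?B P L" using E L by (auto simp: supported_def labels_def)
  ultimately show ?thesis using that B by blast
qed

lemma one_loop_labels:
  assumes sc: "strongly_connected_on {..<7} E" and E: "finite E" "E \<subseteq> {..<7} \<times> {..<7}" "\<And>x. (x, x) \<notin> E"
    and card: "card E \<le> 9" and ij: "(i, j) \<in> E" "(j, i) \<in> E"
  obtains a t u v vs where "1 \<le> a" "a \<le> 5" "t < 2" "u < 2 + a" "v < 2 + a"
    "labels E vs (one_loop_pattern a t u v)"
proof -
  have "i \<noteq> j" using E(3) ij by auto
  have V: "i < 7" "j < 7" using E(2) ij by auto
  have ne: "set [i, j] \<noteq> {..<7}"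
  proof
    assume "set [i, j] = {..<7}"
    then have "card (set [i, j]) = card {..<7::nat}" by (rule arg_cong)
    then show False using \<open>i \<noteq> j\<close> by simp
  qed
  have sub: "set [i, j] \<subseteq> {..<7}" using V by simp
  obtain s y where sy: "s < length [i, j]" "([i, j] ! s, y) \<in> E" "y \<in> {..<7} - set [i, j]"
    by (rule exit_arc[OF sc sub ne]) simp
  \<comment> \<open>The end of the 2-cycle with an arc leaving it is renamed to label 0.\<close>
  define w z where "w = [i, j] ! s" and "z = [i, j] ! (1 - s)"
  have "s = 0 \<or> s = 1" using sy(1) by auto
  then have wz: "w \<noteq> z" "(w, z) \<in> E" "(z, w) \<in> E" "{w, z} = {i, j}"
    using ij \<open>i \<noteq> j\<close> by (auto simp: w_def z_def)
  have R0: "realizes E [w, z] [(0, 1), (1, 0)]" using wz by (simp add: realizes_def)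
  have sub: "set [w, z] \<subseteq> {..<7}" and y: "y \<in> {..<7} - set [w, z]"
    using wz(4) sub sy(3) by auto
  have s0: "0 < length [w, z]" and wy: "([w, z] ! 0, y) \<in> E" using sy(2) by (simp_all add: w_def)
  obtain xs t where xs: "xs \<noteq> []" "t < length [w, z]" "set ([w, z] @ xs) \<subseteq> {..<7}"
    "realizes E ([w, z] @ xs) ([(0, 1), (1, 0)] @ ear (length [w, z]) (length xs) 0 t)"
    by (rule add_ear[OF sc R0 sub s0 wy y])
  define vs where "vs = [w, z] @ xs"
  define a where "a = length xs"
  define P where "P = [(0, 1), (1, 0)] @ ear 2 a 0 t"
  have R: "realizes E vs P" using xs(4) by (simp add: vs_def P_def a_def numeral_2_eq_2)
  have P: "length P = 3 + a" by (simp add: P_def length_ear)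
  have vs: "distinct vs" "length vs = 2 + a" "set vs \<subseteq> {..<7}" "vs \<noteq> []"
    using R xs(3) by (auto simp: realizes_def vs_def a_def)
  have cvs: "card (set vs) = 2 + a" using vs distinct_card by metis
  then have "2 + a \<le> 7" using card_mono[OF _ vs(3)] by simp
  then have a: "1 \<le> a" "a \<le> 5" using xs(1) by (auto simp: a_def Suc_le_eq)
  show ?thesis
  proof (cases "a = 5")
    case True
    then have V: "set vs = {..<7}" using vs(3) cvs by (intro card_subset_eq) auto
    have "8 \<le> card E" using realizes_length_le[OF R E(1)] P True by simp
    then consider "card E \<le> length P" | "card E = Suc (length P)" using card P True by linarith
    then show ?thesis
    proof cases
      case 1
      \<comment> \<open>No chord exists; an arbitrary superfluous one makes the pattern uniform.\<close>
      have "labels E vs P" by (rule realizes_labels[OF R E(1) V 1 E(3)])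
      moreover have "(2, 0) \<notin> set P" using True xs(2) by (auto simp: P_def ear_def upt_rec)
      ultimately have "labels E vs (P @ [(2, 0)])" by (auto simp: labels_def)
      then have "labels E vs (one_loop_pattern a t 2 0)"
        by (simp add: one_loop_pattern_def P_def True ear_def)
      then show ?thesis using that[of a t 2 0 vs] a xs(2) by simp
    next
      case 2
      have sub: "E \<subseteq> set vs \<times> set vs" using E(2) V by simp
      obtain k l where kl: "k < length vs" "l < length vs" "realizes E vs (P @ ear (length vs) 0 k l)"
        by (rule add_chord[OF R E(1) sub 2])
      have "labels E vs (P @ ear (length vs) 0 k l)"
        by (rule realizes_labels[OF kl(3) E(1) V _ E(3)]) (simp add: 2 length_ear)
      then have "labels E vs (one_loop_pattern a t k l)"
        by (simp add: one_loop_pattern_def P_def True vs(2))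
      then show ?thesis using that[of a t k l vs] a xs(2) kl vs(2) by simp
    qed
  next
    case False
    have ne: "set vs \<noteq> {..<7}"
    proof
      assume "set vs = {..<7}"
      then have "card (set vs) = 7" by simp
      then show False using cvs False by simp
    qed
    obtain u y' where u: "u < length vs" "(vs ! u, y') \<in> E" "y' \<in> {..<7} - set vs"
      by (rule exit_arc[OF sc vs(3) ne vs(4)])
    obtain ys v where ys: "ys \<noteq> []" "v < length vs" "set (vs @ ys) \<subseteq> {..<7}"
      "realizes E (vs @ ys) (P @ ear (length vs) (length ys) u v)"
      by (rule add_ear[OF sc R vs(3) u])
    have dist: "distinct (vs @ ys)" using ys(4) by (simp add: realizes_def)
    then have c: "card (set (vs @ ys)) = 2 + a + length ys"
      using distinct_card[OF dist] vs(2) by simp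
    then have le: "2 + a + length ys \<le> 7" using card_mono[OF _ ys(3)] by simp
    \<comment> \<open>Write \<open>b\<close> for the length of \<open>ys\<close>. The pattern has
      \<open>4 + a + b\<close> arcs; each of the \<open>5 - a - b\<close> missing vertices would add
      one and the exit arc another, making 10.\<close>
    have V: "set (vs @ ys) = {..<7}"
    proof (rule ccontr)
      assume "set (vs @ ys) \<noteq> {..<7}"
      from realizes_length_less[OF sc E(1) _ ys(4,3) this] vs(4)
      show False using card P le vs(2) by (simp add: length_ear)
    qed
    then have b: "length ys = 5 - a" using c by simp
    have "labels E (vs @ ys) (P @ ear (length vs) (length ys) u v)"
      by (rule realizes_labels[OF ys(4) E(1) V _ E(3)]) (use card P b a in \<open>simp add: length_ear\<close>)
    then have "labels E (vs @ ys) (one_loop_pattern a t u v)"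
      by (simp add: one_loop_pattern_def P_def b vs(2))
    then show ?thesis using that[of a t u v "vs @ ys"] a xs(2) u(1) ys(2) vs(2) by simp
  qed
qed

lemma several_loops_labels:
  assumes sc: "strongly_connected_on {..<7} E" and E: "finite E" "E \<subseteq> {..<7} \<times> {..<7}" "\<And>x. (x, x) \<notin> E"
    and card: "card E \<le> 8" and r: "r < 7"
  obtains (two) a u v vs where "1 \<le> a" "a \<le> 6" "u < 1 + a" "v < 1 + a" "vs ! 0 = r"
      "labels E vs (two_loop_pattern a u v)" "card E = 8"
    | (three) vs where "vs ! 0 = r" "labels E vs (ear 1 6 0 0)" "card E = 7"
proof -
  have ne: "set [r] \<noteq> {..<7}"
  proof
    assume "set [r] = {..<7}"
    then have "card (set [r]) = card {..<7::nat}" by (rule arg_cong)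
    then show False by simp
  qed
  \<comment> \<open>Starting from the single vertex \<open>r\<close>, the first ear must return to
    \<open>r\<close> and is a cycle through it.\<close>
  have R0: "realizes E [r] []" and sub: "set [r] \<subseteq> {..<7}" using r by (simp_all add: realizes_def)
  obtain s y where sy: "s < length [r]" "([r] ! s, y) \<in> E" "y \<in> {..<7} - set [r]"
    by (rule exit_arc[OF sc sub ne]) simp
  obtain xs t where xs: "xs \<noteq> []" "t < length [r]" "set ([r] @ xs) \<subseteq> {..<7}"
    "realizes E ([r] @ xs) ([] @ ear (length [r]) (length xs) s t)"
    by (rule add_ear[OF sc R0 sub sy])
  define vs where "vs = [r] @ xs"
  define a where "a = length xs"
  define P where "P = ear 1 a 0 0"
  have R: "realizes E vs P" using xs(2,4) sy(1) by (simp add: vs_def P_def a_def)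
  have P: "length P = 1 + a" by (simp add: P_def length_ear)
  have vs: "distinct vs" "length vs = 1 + a" "set vs \<subseteq> {..<7}" "vs \<noteq> []"
    using R xs(3) by (auto simp: realizes_def vs_def a_def)
  have cvs: "card (set vs) = 1 + a" using vs distinct_card by metis
  then have "1 + a \<le> 7" using card_mono[OF _ vs(3)] by simp
  then have a: "1 \<le> a" "a \<le> 6" using xs(1) by (auto simp: a_def Suc_le_eq)
  show ?thesis
  proof (cases "a = 6")
    case True
    then have V: "set vs = {..<7}" using vs(3) cvs by (intro card_subset_eq) auto
    have "7 \<le> card E" using realizes_length_le[OF R E(1)] P True by simp
    then consider "card E = length P" | "card E = Suc (length P)" using card P True by linarith
    then show ?thesis
    proof cases
      case 1
      have "labels E vs P" by (rule realizes_labels[OF R E(1) V _ E(3)]) (simp add: 1)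
      then show ?thesis using three[of vs] 1 True P by (simp add: P_def vs_def)
    next
      case 2
      have sub: "E \<subseteq> set vs \<times> set vs" using E(2) V by simp
      obtain k l where kl: "k < length vs" "l < length vs" "realizes E vs (P @ ear (length vs) 0 k l)"
        by (rule add_chord[OF R E(1) sub 2])
      have "labels E vs (P @ ear (length vs) 0 k l)"
        by (rule realizes_labels[OF kl(3) E(1) V _ E(3)]) (simp add: 2 length_ear)
      then have "labels E vs (two_loop_pattern a k l)"
        by (simp add: two_loop_pattern_def P_def True vs(2))
      then show ?thesis using two[of a k l vs] a kl vs(2) 2 P True by (simp add: vs_def)
    qed
  next
    case False
    have ne: "set vs \<noteq> {..<7}"
    proof
      assume "set vs = {..<7}"
      then have "card (set vs) = 7" by simp
      then show False using cvs False by simp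
    qed
    obtain u y' where u: "u < length vs" "(vs ! u, y') \<in> E" "y' \<in> {..<7} - set vs"
      by (rule exit_arc[OF sc vs(3) ne vs(4)])
    obtain ys v where ys: "ys \<noteq> []" "v < length vs" "set (vs @ ys) \<subseteq> {..<7}"
      "realizes E (vs @ ys) (P @ ear (length vs) (length ys) u v)"
      by (rule add_ear[OF sc R vs(3) u])
    have dist: "distinct (vs @ ys)" using ys(4) by (simp add: realizes_def)
    then have c: "card (set (vs @ ys)) = 1 + a + length ys"
      using distinct_card[OF dist] vs(2) by simp
    then have le: "1 + a + length ys \<le> 7" using card_mono[OF _ ys(3)] by simp
    have V: "set (vs @ ys) = {..<7}"
    proof (rule ccontr)
      assume "set (vs @ ys) \<noteq> {..<7}"
      from realizes_length_less[OF sc E(1) _ ys(4,3) this] vs(4)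
      show False using card P le vs(2) by (simp add: length_ear)
    qed
    then have b: "length ys = 6 - a" using c by simp
    have "labels E (vs @ ys) (P @ ear (length vs) (length ys) u v)"
      by (rule realizes_labels[OF ys(4) E(1) V _ E(3)]) (use card P b a in \<open>simp add: length_ear\<close>)
    then have "labels E (vs @ ys) (two_loop_pattern a u v)"
      by (simp add: two_loop_pattern_def P_def b vs(2))
    moreover have "card E = 8" using realizes_length_le[OF ys(4) E(1)] card P b a by (simp add: length_ear)
    ultimately show ?thesis using two[of a u v "vs @ ys"] a u(1) ys(2) vs(2) by (simp add: vs_def)
  qed
qed

section \<open>Counting loops and arcs of a stable irreducible matrix\<close>

lemma num_nonzero_diagonal:
  assumes "A \<in> carrier_mat n n"
  shows "num_nonzero A = card {(i, j). i < n \<and> j < n \<and> i \<noteq> j \<and> A $$ (i, j) \<noteq> 0}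
    + card {i. i < n \<and> A $$ (i, i) \<noteq> 0}" (is "_ = card ?E + card ?L")
proof -
  have "{(i, j). i < n \<and> j < n \<and> A $$ (i, j) \<noteq> 0} = ?E \<union> (\<lambda>i. (i, i)) ` ?L" by auto
  moreover have "finite ?E" by (rule finite_subset[of _ "{..<n} \<times> {..<n}"]) auto
  moreover have "card ((\<lambda>i. (i, i)) ` ?L) = card ?L" by (simp add: card_image inj_on_def)
  moreover have "?E \<inter> (\<lambda>i. (i, i)) ` ?L = {}" by auto
  ultimately show ?thesis using assms by (simp add: num_nonzero_def card_Un_disjoint)
qed

lemma stable_irreducible_num_nonzero:
  assumes A: "A \<in> carrier_mat 7 7" "irreducible_mat 7 A" "stable A"
  shows "num_nonzero A \<ge> 11"
proof (rule ccontr)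
  assume few: "\<not> num_nonzero A \<ge> 11"
  let ?E = "{(i, j). i < 7 \<and> j < 7 \<and> i \<noteq> j \<and> A $$ (i, j) \<noteq> 0}"
  let ?L = "{i. i < 7 \<and> A $$ (i, i) \<noteq> 0}"
  have card: "card ?E + card ?L \<le> 10"
    using few num_nonzero_diagonal[OF A(1)] by simp
  have E: "finite ?E" "?E \<subseteq> {..<7} \<times> {..<7}" "\<And>x. (x, x) \<notin> ?E"
    by (rule finite_subset[of _ "{..<7} \<times> {..<7}"]) auto
  have sc: "strongly_connected_on {..<7} ?E"
    unfolding strongly_connected_on_def
  proof (intro allI impI)
    fix X :: "nat set" assume X: "X \<subset> {..<7}" "X \<noteq> {}"
    from irreducible_matD[OF A(1,2) X]
    obtain x y where "x \<in> X" "y \<in> {..<7} - X" "A $$ (x, y) \<noteq> 0" by blast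
    then show "\<exists>x\<in>X. \<exists>y\<in>{..<7} - X. (x, y) \<in> ?E" using X by blast
  qed
  have deg: "degree (char_poly A) = 7" "lead_coeff (char_poly A) = 1"
    using degree_monic_char_poly[OF A(1)] by auto
  have "hurwitz (char_poly A)" using A stable_hurwitz by blast
  from hurwitz_coeffs(1)[OF this deg(2)]
  have coeff: "coeff (char_poly A) (7 - k) \<noteq> 0" for k using deg(1) by (simp add: less_imp_neq[symmetric])
  obtain p S where 1: "S \<subseteq> {..<7}" "card S = 1" "p permutes S" "\<forall>i\<in>S. A $$ (i, p i) \<noteq> 0"
    using char_poly_coeff_cycle_cover[OF A(1) coeff[of 1]] by auto
  obtain r where S: "S = {r}" using 1(2) by (rule card_1_singletonE)
  have r: "r \<in> ?L" using 1 permutes_in_image[OF 1(3), of r] by (auto simp: S)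
  have finL: "finite ?L" by simp
  show False
  proof (cases "card ?L = 1")
    case True
    then obtain r0 where "?L = {r0}" by (rule card_1_singletonE)
    then have L: "?L = {r}" using r by (metis singletonD)
    obtain q T where 2: "T \<subseteq> {..<7}" "card T = 2" "q permutes T" "\<forall>i\<in>T. A $$ (i, q i) \<noteq> 0"
      using char_poly_coeff_cycle_cover[OF A(1) coeff[of 2]] by auto
    obtain i j where T: "T = {i, j}" "i \<noteq> j" using 2(2) by (auto simp: card_2_iff)
    have "q i \<in> {i, j}" "q j \<in> {i, j}" "q i \<noteq> q j"
      using permutes_in_image[OF 2(3)] permutes_inj[OF 2(3)] T by (auto dest: injD)
    moreover have "\<not> (q i = i \<and> q j = j)"
    proof
      assume "q i = i \<and> q j = j"
      then have "i \<in> ?L" "j \<in> ?L" using 2 T by auto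
      then show False using L T(2) by auto
    qed
    ultimately have "q i = j" "q j = i" by auto
    then have ij: "(i, j) \<in> ?E" "(j, i) \<in> ?E" using 2 T by auto
    have few_arcs: "card ?E \<le> 9" using card True by simp
    obtain a t u v vs where lab: "1 \<le> a" "a \<le> 5" "t < 2" "u < 2 + a" "v < 2 + a"
      "labels ?E vs (one_loop_pattern a t u v)"
      by (rule one_loop_labels[OF sc E few_arcs ij])
    have "r < 7" using r by simp
    then obtain l where l: "l < 7" "vs ! l = r" using labels_index[OF lab(6)] by blast
    obtain B where "B \<in> carrier_mat 7 7" "stable B" "supported B (one_loop_pattern a t u v) [l]"
      by (rule labels_supported[OF A(1,3) lab(6), of "[l]"]) (use l L in auto)
    then show False using one_loop_not_stable lab l by blast
  next
    case False
    have "card ?L > 0" using r finL by (auto simp: card_gt_0_iff)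
    then have L2: "card ?L \<ge> 2" using False by linarith
    then have few_arcs: "card ?E \<le> 8" using card by linarith
    have "r < 7" using r by simp
    consider (two) a u v vs where "1 \<le> a" "a \<le> 6" "u < 1 + a" "v < 1 + a" "vs ! 0 = r"
      "labels ?E vs (two_loop_pattern a u v)" "card ?E = 8"
    | (three) vs where "vs ! 0 = r" "labels ?E vs (ear 1 6 0 0)" "card ?E = 7"
      by (rule several_loops_labels[OF sc E few_arcs \<open>r < 7\<close>])
    then show False
    proof cases
      case two
      have "card ?L = 2" using L2 card two(7) by linarith
      then obtain x y where "?L = {x, y}" "x \<noteq> y" by (auto simp only: card_2_iff)
      then obtain r' where r': "?L = {r, r'}" "r \<noteq> r'" using r by (metis insertE insert_commute singletonD)
      then have "r' < 7" by auto
      then obtain l where l: "l < 7" "vs ! l = r'" using labels_index[OF two(6)] by blast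
      then have "1 \<le> l" using r'(2) two(5) by (cases l) auto
      moreover obtain B where "B \<in> carrier_mat 7 7" "stable B" "supported B (two_loop_pattern a u v) [0, l]"
        by (rule labels_supported[OF A(1,3) two(6), of "[0, l]"]) (use l r' two(5) \<open>1 \<le> l\<close> in auto)
      ultimately show False using two_loop_not_stable two l by blast
    next
      case three
      have vs: "distinct vs" "set vs = {..<7}" using three(2) by (auto simp: labels_def)
      then have len: "length vs = 7" using distinct_card[of vs] by simp
      define I where "I = {i. i < 7 \<and> vs ! i \<in> ?L}"
      have "inj_on ((!) vs) I" using vs(1) len by (auto simp: I_def inj_on_def nth_eq_iff_index_eq)
      moreover have "(!) vs ` I \<subseteq> ?L" by (auto simp: I_def)
      ultimately have "card I \<le> card ?L" using finL by (rule card_inj_on_le)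
      moreover have "finite I" by (simp add: I_def)
      moreover have "0 \<in> I" using three(1) r by (simp add: I_def)
      ultimately have "card (I - {0}) \<le> 2" using card three(3) by simp
      moreover have "I - {0} \<subseteq> {1..<7}" by (auto simp: I_def)
      \<comment> \<open>Besides \<open>r\<close> there may be one or two loops; padding to exactly
        two positions lets one check serve both cases.\<close>
      ultimately obtain J where J: "I - {0} \<subseteq> J" "J \<subseteq> {1..<7}" "card J = 2"
        using exists_subset_between[of "I - {0}" 2 "{1..<7}"] by auto
      then obtain l l' where l: "J = {l, l'}" "l \<noteq> l'" by (auto simp only: card_2_iff)
      have bounds: "1 \<le> l" "l < 7" "1 \<le> l'" "l' < 7" using J(2) by (auto simp: l)
      have "?L \<subseteq> (!) vs ` set [0, l, l']"
      proof
        fix x assume x: "x \<in> ?L"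
        then have "x < 7" by simp
        then obtain i where i: "i < 7" "vs ! i = x" using labels_index[OF three(2)] by blast
        then have "i \<in> I" using x by (simp add: I_def)
        then have "i \<in> set [0, l, l']" using J(1) l(1) by auto
        then show "x \<in> (!) vs ` set [0, l, l']" using i(2) by blast
      qed
      moreover have "distinct [0, l, l']" "set [0, l, l'] \<subseteq> {..<7}" using l(2) bounds by auto
      ultimately obtain B where "B \<in> carrier_mat 7 7" "stable B" "supported B (ear 1 6 0 0) [0, l, l']"
        using labels_supported[OF A(1,3) three(2)] by blast
      then show False using three_loop_not_stable bounds by blast
    qed
  qed
qed

theorem theorem2:
  shows "min_nonzero 7 = 2 * 7 - 3 \<and> min_nonzero 7 = 11"
proof -
  have "min_nonzero 7 = 11"
    unfolding min_nonzero_def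
  proof (rule cInf_eq_minimum)
    have "sign_pattern example_mat \<in> carrier_mat 7 7"
      using example_mat_carrier by (simp add: sign_pattern_def)
    moreover have "irreducible_mat 7 (sign_pattern example_mat)"
      using irreducible_sign_pattern[OF example_mat_carrier] irreducible_example_mat by simp
    moreover have "potentially_stable 7 (sign_pattern example_mat)"
      unfolding potentially_stable_def using example_mat_carrier stable_example_mat by blast
    moreover have "11 = num_nonzero (sign_pattern example_mat)"
      by (simp add: num_nonzero_sign_pattern num_nonzero_example_mat)
    ultimately show "11 \<in> {num_nonzero S |S. S \<in> carrier_mat 7 7 \<and> irreducible_mat 7 S \<and> potentially_stable 7 S}"
      by blast
  next
    fix k
    assume "k \<in> {num_nonzero S |S. S \<in> carrier_mat 7 7 \<and> irreducible_mat 7 S \<and> potentially_stable 7 S}"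
    then obtain A where "A \<in> carrier_mat 7 7" "stable A" "irreducible_mat 7 (sign_pattern A)"
      "k = num_nonzero (sign_pattern A)"
      by (auto simp: potentially_stable_def)
    then show "11 \<le> k"
      using stable_irreducible_num_nonzero irreducible_sign_pattern num_nonzero_sign_pattern by metis
  qed
  then show ?thesis by simp
qed

end
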